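(* Let $f$ be a holomorphic function on the bidisc $\mathbb{D}^2$ with $f(0)=0$ and $\sup_{z\in\mathbb{D}^2}|f(z)|\le 1$. Define one-variable polynomials \[p_1(z)=\frac{\partial f}{\partial z_1}(0)+\frac{\partial f}{\partial z_2}(0)z,\qquad p_2(z)=\frac12\frac{\partial^2f}{\partial z_1^2}(0)+\frac{\partial^2f}{\partial z_1\partial z_2}(0)z+\frac12\frac{\partial^2f}{\partial z_2^2}(0)z^2.\] Then \[\sup_{\|X\|_\infty\le 1}\left\|\mathscr{T}\left(Df(0)\cdot X,\ \tfrac12D^2f(0)\cdot A_X\right)\right\|=\|\mathscr{T}(M_{p_1},M_{p_2})\|,\] where the supremum is over all pairs $X=(X_1,X_2)$ of commuting bounded operators on a nonzero separable complex Hilbert space with $\|X\|_\infty:=\max\{\|X_1\|,\|X_2\|\}\le 1$.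
   Context: For bounded operators $A_1,A_2$ on a Hilbert space, $\mathscr{T}(A_1,A_2)=\begin{pmatrix}A_1&A_2\\0&A_1\end{pmatrix}$. $Df(0)\cdot X=\frac{\partial f}{\partial z_1}(0)X_1+\frac{\partial f}{\partial z_2}(0)X_2$; $A_X=(X_iX_j)_{i,j}$ and $D^2f(0)\cdot A_X=\sum_{i,j=1}^2\frac{\partial^2f}{\partial z_i\partial z_j}(0)X_iX_j$. For a polynomial $p$, $M_p$ is the operator of multiplication by $p$ on $L^2(\mathbb{T})$, with $\mathbb{T}$ the unit circle. *)

theory Defs
  imports "HOL-Analysis.Analysis" "HOL-Algebra.Module" "HOL-Computational_Algebra.Polynomial"
begin

section \<open>Hilbert spaces with explicit carrier\<close>

text \<open>A supremum over all Hilbert spaces has to quantify over the spaces inside a formula, so a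
  Hilbert space is a record with a carrier set, in the style of HOL-Algebra.  The \<open>mult\<close> and
  \<open>one\<close> fields inherited from the module record play no role.\<close>

definition complex_ring :: "complex ring" where
  "complex_ring = \<lparr>carrier = UNIV, mult = (*), one = 1, zero = 0, add = (+)\<rparr>"

record 'a hilb = "(complex, 'a) module" +
  ip :: "'a \<Rightarrow> 'a \<Rightarrow> complex"

definition hnorm :: "'a hilb \<Rightarrow> 'a \<Rightarrow> real" where
  "hnorm H x = sqrt (Re (ip H x x))"

text \<open>The value 0 outside the carrier is there because the locale \<open>Metric_space\<close> demands symmetry
  and nonnegativity on the whole type.\<close>

definition hdist :: "'a hilb \<Rightarrow> 'a \<Rightarrow> 'a \<Rightarrow> real" where
  "hdist H x y = (if x \<in> carrier H \<and> y \<in> carrier H then hnorm H (x \<ominus>\<^bsub>H\<^esub> y) else 0)"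

locale hilbert_space = Module.module complex_ring H for H :: "'a hilb" (structure) +
  assumes ip_add: "\<lbrakk>x \<in> carrier H; y \<in> carrier H; z \<in> carrier H\<rbrakk>
      \<Longrightarrow> ip H (x \<oplus> y) z = ip H x z + ip H y z"
    and ip_smult: "\<lbrakk>x \<in> carrier H; y \<in> carrier H\<rbrakk> \<Longrightarrow> ip H (c \<odot> x) y = c * ip H x y"
    and ip_cnj: "\<lbrakk>x \<in> carrier H; y \<in> carrier H\<rbrakk> \<Longrightarrow> ip H y x = cnj (ip H x y)"
    and ip_pos: "\<lbrakk>x \<in> carrier H; x \<noteq> \<zero>\<rbrakk> \<Longrightarrow> Re (ip H x x) > 0"
    and complete: "Metric_space.mcomplete (carrier H) (hdist H)"

definition separable_hilbert_space :: "'a hilb \<Rightarrow> bool" where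
  "separable_hilbert_space H \<longleftrightarrow>
     hilbert_space H \<and> separable_space (Metric_space.mtopology (carrier H) (hdist H))"

definition hsum :: "'a hilb \<Rightarrow> 'b hilb \<Rightarrow> ('a \<times> 'b) hilb" where
  "hsum H K =
    \<lparr>carrier = carrier H \<times> carrier K, mult = undefined, one = undefined,
     zero = (\<zero>\<^bsub>H\<^esub>, \<zero>\<^bsub>K\<^esub>),
     add = (\<lambda>(x, y) (x', y'). (x \<oplus>\<^bsub>H\<^esub> x', y \<oplus>\<^bsub>K\<^esub> y')),
     smult = (\<lambda>c (x, y). (c \<odot>\<^bsub>H\<^esub> x, c \<odot>\<^bsub>K\<^esub> y)),
     ip = (\<lambda>(x, y) (x', y'). ip H x x' + ip K y y')\<rparr>"

text \<open>A type carries a nonzero Hilbert space only if the complex numbers inject into it.  So a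
  supremum over the nonzero Hilbert spaces with carrier in a type \<open>'a\<close> only makes sense under
  that cardinality condition, which excludes no Hilbert space.\<close>

lemma hilbert_space_imp_inj:
  fixes H :: "'a hilb"
  assumes "hilbert_space H" and "carrier H \<noteq> {\<zero>\<^bsub>H\<^esub>}"
  shows "\<exists>e :: complex \<Rightarrow> 'a. inj e"
proof -
  interpret hilbert_space H by fact
  obtain x where x: "x \<in> carrier H" "x \<noteq> \<zero>\<^bsub>H\<^esub>"
    using assms(2) M.zero_closed by blast
  have "inj (\<lambda>c. c \<odot>\<^bsub>H\<^esub> x)"
  proof (rule injI)
    fix c d assume "c \<odot>\<^bsub>H\<^esub> x = d \<odot>\<^bsub>H\<^esub> x"
    then have "c * ip H x x = d * ip H x x"
      using ip_smult[OF x(1) x(1)] by metis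
    then show "c = d" using ip_pos[OF x] by auto
  qed
  then show ?thesis by blast
qed

section \<open>Operators\<close>

text \<open>Only the values of an operator on the carrier matter.\<close>

definition bounded_operator :: "'a hilb \<Rightarrow> ('a \<Rightarrow> 'a) \<Rightarrow> bool" where
  "bounded_operator H A \<longleftrightarrow>
     A \<in> carrier H \<rightarrow> carrier H \<and>
     (\<forall>x\<in>carrier H. \<forall>y\<in>carrier H. A (x \<oplus>\<^bsub>H\<^esub> y) = A x \<oplus>\<^bsub>H\<^esub> A y) \<and>
     (\<forall>c. \<forall>x\<in>carrier H. A (c \<odot>\<^bsub>H\<^esub> x) = c \<odot>\<^bsub>H\<^esub> A x) \<and>
     (\<exists>B. \<forall>x\<in>carrier H. hnorm H (A x) \<le> B * hnorm H x)"

definition commuting_ops :: "'a hilb \<Rightarrow> ('a \<Rightarrow> 'a) \<Rightarrow> ('a \<Rightarrow> 'a) \<Rightarrow> bool" where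
  "commuting_ops H A B \<longleftrightarrow> (\<forall>x\<in>carrier H. A (B x) = B (A x))"

text \<open>Extended real values, so that suprema of unbounded or empty sets have their usual meaning.\<close>

definition op_norm :: "'a hilb \<Rightarrow> ('a \<Rightarrow> 'a) \<Rightarrow> ereal" where
  "op_norm H A = (SUP x\<in>{x \<in> carrier H. hnorm H x \<le> 1}. ereal (hnorm H (A x)))"

definition pair_norm :: "'a hilb \<Rightarrow> (2 \<Rightarrow> 'a \<Rightarrow> 'a) \<Rightarrow> ereal" where
  "pair_norm H X = max (op_norm H (X 1)) (op_norm H (X 2))"

text \<open>The operator matrix with rows \<open>(A1, A2)\<close> and \<open>(0, A1)\<close>, acting on \<open>hsum H H\<close>.\<close>

definition toeplitz :: "'a hilb \<Rightarrow> ('a \<Rightarrow> 'a) \<Rightarrow> ('a \<Rightarrow> 'a) \<Rightarrow> 'a \<times> 'a \<Rightarrow> 'a \<times> 'a" where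
  "toeplitz H A1 A2 = (\<lambda>(x, y). (A1 x \<oplus>\<^bsub>H\<^esub> A2 y, A1 y))"

section \<open>Holomorphic functions of two variables\<close>

definition bidisc :: "(complex ^ 2) set" where
  "bidisc = {z. \<forall>i. norm (z $ i) < 1}"

text \<open>Complex differentiability in several variables: the Frechet derivative exists and is
  complex-linear.\<close>

definition holomorphic2_on :: "(complex ^ 2 \<Rightarrow> complex) \<Rightarrow> (complex ^ 2) set \<Rightarrow> bool" where
  "holomorphic2_on f S \<longleftrightarrow>
     (\<forall>z\<in>S. \<exists>a :: complex ^ 2. (f has_derivative (\<lambda>h. \<Sum>i\<in>UNIV. a $ i * h $ i)) (at z within S))"

definition partial :: "2 \<Rightarrow> (complex ^ 2 \<Rightarrow> complex) \<Rightarrow> complex ^ 2 \<Rightarrow> complex" where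
  "partial i f z = deriv (\<lambda>w. f (\<chi> j. if j = i then w else z $ j)) (z $ i)"

definition D_op :: "'a hilb \<Rightarrow> (complex ^ 2 \<Rightarrow> complex) \<Rightarrow> (2 \<Rightarrow> 'a \<Rightarrow> 'a) \<Rightarrow> 'a \<Rightarrow> 'a" where
  "D_op H f X = (\<lambda>x. \<Oplus>\<^bsub>H\<^esub>i\<in>UNIV. partial i f 0 \<odot>\<^bsub>H\<^esub> X i x)"

definition D2_op ::
    "'a hilb \<Rightarrow> (complex ^ 2 \<Rightarrow> complex) \<Rightarrow> (2 \<Rightarrow> 2 \<Rightarrow> 'a \<Rightarrow> 'a) \<Rightarrow> 'a \<Rightarrow> 'a" where
  "D2_op H f A = (\<lambda>x. \<Oplus>\<^bsub>H\<^esub>i\<in>UNIV. \<Oplus>\<^bsub>H\<^esub>j\<in>UNIV. partial i (partial j f) 0 \<odot>\<^bsub>H\<^esub> A i j x)"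

definition A_mat :: "(2 \<Rightarrow> 'a \<Rightarrow> 'a) \<Rightarrow> 2 \<Rightarrow> 2 \<Rightarrow> 'a \<Rightarrow> 'a" where
  "A_mat X i j = X i \<circ> X j"

definition p1 :: "(complex ^ 2 \<Rightarrow> complex) \<Rightarrow> complex poly" where
  "p1 f = [:partial 1 f 0, partial 2 f 0:]"

definition p2 :: "(complex ^ 2 \<Rightarrow> complex) \<Rightarrow> complex poly" where
  "p2 f = [:1/2 * partial 1 (partial 1 f) 0, partial 1 (partial 2 f) 0,
            1/2 * partial 2 (partial 2 f) 0:]"

section \<open>Square-integrable functions and multiplication operators\<close>

definition square_integrable :: "'b measure \<Rightarrow> ('b \<Rightarrow> complex) \<Rightarrow> bool" where
  "square_integrable M f \<longleftrightarrow>
     f \<in> borel_measurable M \<and> integrable M (\<lambda>x. (norm (f x))\<^sup>2)"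

definition L2_rel :: "'b measure \<Rightarrow> (('b \<Rightarrow> complex) \<times> ('b \<Rightarrow> complex)) set" where
  "L2_rel M = {(f, g). square_integrable M f \<and> square_integrable M g \<and> (AE x in M. f x = g x)}"

definition L2_class :: "'b measure \<Rightarrow> ('b \<Rightarrow> complex) \<Rightarrow> ('b \<Rightarrow> complex) set" where
  "L2_class M f = L2_rel M `` {f}"

text \<open>The unions below are over representatives; all members of each union coincide, since the
  operations respect almost everywhere equality.\<close>

definition L2 :: "'b measure \<Rightarrow> ('b \<Rightarrow> complex) set hilb" where
  "L2 M =
    \<lparr>carrier = {f. square_integrable M f} // L2_rel M, mult = undefined, one = undefined,
     zero = L2_class M (\<lambda>x. 0),
     add = (\<lambda>F G. \<Union>f\<in>F. \<Union>g\<in>G. L2_class M (\<lambda>x. f x + g x)),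
     smult = (\<lambda>c F. \<Union>f\<in>F. L2_class M (\<lambda>x. c * f x)),
     ip = (\<lambda>F G. the_elem (\<Union>f\<in>F. \<Union>g\<in>G. {\<integral>x. f x * cnj (g x) \<partial>M}))\<rparr>"

definition circle_measure :: "complex measure" where
  "circle_measure =
     distr (uniform_measure lborel {0..2 * pi}) (restrict_space borel (sphere 0 1)) cis"

definition mult_op :: "complex poly \<Rightarrow> (complex \<Rightarrow> complex) set \<Rightarrow> (complex \<Rightarrow> complex) set" where
  "mult_op p F = (\<Union>f\<in>F. L2_class circle_measure (\<lambda>z. poly p z * f z))"

end

theory Submission
  imports Defs "HOL-Complex_Analysis.Complex_Analysis"
begin

text \<open>
  Both sides are equal to the supremum, over the points \<open>t\<close> of the unit circle, of the norm of the
  matrix \<open>T(t)\<close> with rows \<open>(p1(t), p2(t))\<close> and \<open>(0, p1(t))\<close>, acting on pairs of complex numbers.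

  On the right this is the usual computation for multiplication operators: the matrix of
  multiplication operators acts pointwise, which gives \<open>\<le>\<close> by integration
  (\<open>op_norm_toeplitz_mult_op_le\<close>), and constant vectors times the indicator of a small arc give \<open>\<ge>\<close>
  (\<open>op_norm_toeplitz_mult_op_ge\<close>).  On the left, the pair \<open>(1, t)\<close> on a one-dimensional space turns
  the operator matrix into \<open>T(t)\<close>, so the left side is at least this supremum
  (\<open>op_norm_scalar_pair_ge\<close>).

  The remaining inequality concerns commuting contractions \<open>X1\<close>, \<open>X2\<close>.  If they were unitary, then
  with \<open>W = X1\<^sup>-\<^sup>1 X2\<close> the first- and second-order terms would be \<open>X1 p1(W)\<close> and \<open>X1\<^sup>2 p2(W)\<close>; the
  factors \<open>X1\<close> can be removed from the matrix by unitary diagonal matrices, and the spectral theorem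
  for \<open>W\<close> would finish the proof.  Ando's theorem reduces contractions to this case, but only five
  vectors matter, so a finite-dimensional substitute is enough.  To bound the image of \<open>(x, y)\<close>, look
  at the vectors \<open>X1 x, X2 x\<close> and \<open>X1 X1 y, X1 X2 y, X2 X2 y\<close>, indexed by the sites
  \<open>x\<^sub>0, x\<^sub>1, y\<^sub>0, y\<^sub>1, y\<^sub>2\<close>.  There is a positive semidefinite kernel on these sites which dominates the
  Gram kernel of the five vectors, has the diagonal entries \<open>\<parallel>x\<parallel>\<^sup>2\<close> and \<open>\<parallel>y\<parallel>\<^sup>2\<close>, and is stationary: it is
  the same on \<open>{x\<^sub>0, y\<^sub>0, y\<^sub>1}\<close> and on \<open>{x\<^sub>1, y\<^sub>1, y\<^sub>2}\<close> (\<open>stationary_window\<close>).  As in Ando's theorem it is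
  built from the defect forms \<open>\<langle>u, v\<rangle> - \<langle>X\<^sub>i u, X\<^sub>i v\<rangle>\<close>, one for each half, and commutativity says
  exactly that the two halves agree at the common site \<open>y\<^sub>1\<close>.  Two positive semidefinite kernels that
  agree on a common part always have a joint extension (\<open>psd_on_glue\<close>); this produces first the window
  and then, by gluing shifted windows, arbitrarily long stationary kernels (\<open>stationary_extension\<close>).
  A finite Fourier transform diagonalizes the shift, so the sum over all windows is bounded by the
  bound for \<open>T(t)\<close> at roots of unity (\<open>cyclic_toeplitz_bound\<close>), and the boundary terms disappear as
  the length tends to infinity (\<open>stationary_toeplitz_bound\<close>).

  Finally, the second-order operator contains the mixed derivative in both orders, while \<open>p2\<close> has only
  one of them; for a bounded holomorphic function they agree (\<open>partial_symmetric\<close>).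
\<close>

section \<open>Positive semidefinite kernels on finite sets\<close>

text \<open>A kernel is used only through its values on \<open>A\<close>, and the coefficient vectors are functions on
  the whole index type, so that one kernel can be restricted and extended without changing types.\<close>


definition sform :: "'i set \<Rightarrow> ('i \<Rightarrow> 'i \<Rightarrow> complex) \<Rightarrow> ('i \<Rightarrow> complex) \<Rightarrow> ('i \<Rightarrow> complex) \<Rightarrow> complex" where
  "sform A K u v = (\<Sum>i\<in>A. \<Sum>j\<in>A. u i * cnj (v j) * K i j)"

definition psd_on :: "'i set \<Rightarrow> ('i \<Rightarrow> 'i \<Rightarrow> complex) \<Rightarrow> bool" where
  "psd_on A K \<longleftrightarrow> (\<forall>i\<in>A. \<forall>j\<in>A. K j i = cnj (K i j)) \<and> (\<forall>u. 0 \<le> Re (sform A K u u))"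

abbreviation qform :: "'i set \<Rightarrow> ('i \<Rightarrow> 'i \<Rightarrow> complex) \<Rightarrow> ('i \<Rightarrow> complex) \<Rightarrow> real" where
  "qform A K u \<equiv> Re (sform A K u u)"

lemma psd_onI:
  assumes "\<And>i j. i \<in> A \<Longrightarrow> j \<in> A \<Longrightarrow> K j i = cnj (K i j)" "\<And>u. 0 \<le> Re (sform A K u u)"
  shows "psd_on A K"
  unfolding psd_on_def using assms by blast

lemma psd_on_cnj: "psd_on A K \<Longrightarrow> i \<in> A \<Longrightarrow> j \<in> A \<Longrightarrow> K j i = cnj (K i j)"
  unfolding psd_on_def by blast

lemma psd_on_nonneg: "psd_on A K \<Longrightarrow> 0 \<le> Re (sform A K u u)"
  unfolding psd_on_def by blast

lemma sform_add_left: "sform A K (\<lambda>i. u i + v i) w = sform A K u w + sform A K v w"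
  by (simp add: sform_def sum.distrib algebra_simps)

lemma sform_add_right: "sform A K w (\<lambda>i. u i + v i) = sform A K w u + sform A K w v"
  by (simp add: sform_def sum.distrib algebra_simps)

lemma sform_scale_left: "sform A K (\<lambda>i. c * u i) w = c * sform A K u w"
  by (simp add: sform_def sum_distrib_left algebra_simps)

lemma sform_scale_right: "sform A K w (\<lambda>i. c * u i) = cnj c * sform A K w u"
  by (simp add: sform_def sum_distrib_left algebra_simps)

lemma sform_sum_left: "sform A K (\<lambda>i. \<Sum>k\<in>S. u k i) w = (\<Sum>k\<in>S. sform A K (u k) w)"
proof (induction S rule: infinite_finite_induct)
  case (insert x F)
  then show ?case by (simp add: sform_add_left)
qed (simp_all add: sform_def)

lemma sform_sum_right: "sform A K w (\<lambda>i. \<Sum>k\<in>S. u k i) = (\<Sum>k\<in>S. sform A K w (u k))"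
proof (induction S rule: infinite_finite_induct)
  case (insert x F)
  then show ?case by (simp add: sform_add_right)
qed (simp_all add: sform_def)

lemma sform_cong: "(\<And>i j. i \<in> A \<Longrightarrow> j \<in> A \<Longrightarrow> K i j = K' i j) \<Longrightarrow> (\<And>i. i \<in> A \<Longrightarrow> u i = u' i)
   \<Longrightarrow> (\<And>i. i \<in> A \<Longrightarrow> v i = v' i) \<Longrightarrow> sform A K u v = sform A K' u' v'"
  unfolding sform_def by (intro sum.cong refl) auto

lemma sform_cnj:
  assumes "psd_on A K"
  shows "sform A K v u = cnj (sform A K u v)"
proof -
  have "sform A K v u = (\<Sum>j\<in>A. \<Sum>i\<in>A. v i * cnj (u j) * K i j)"
    unfolding sform_def by (rule sum.swap)
  also have "\<dots> = (\<Sum>j\<in>A. \<Sum>i\<in>A. cnj (u j * cnj (v i) * K j i))"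
  proof (intro sum.cong refl)
    fix i j assume "i \<in> A" "j \<in> A"
    then show "v i * cnj (u j) * K i j = cnj (u j * cnj (v i) * K j i)"
      using psd_on_cnj[OF assms, of j i] by simp
  qed
  finally show ?thesis by (simp add: sform_def)
qed

lemma sform_real:
  assumes "psd_on A K"
  shows "sform A K u u = of_real (Re (sform A K u u))"
proof -
  have "Im (sform A K u u) = 0"
    using sform_cnj[OF assms, of u u] by (metis Reals_cnj_iff complex_is_Real_iff)
  then show ?thesis by (simp add: complex_eq_iff)
qed

lemma sform_comb:
  assumes "psd_on A K"
  shows "Re (sform A K (\<lambda>i. p * u i + q * v i) (\<lambda>i. p * u i + q * v i)) =
    (cmod p)\<^sup>2 * Re (sform A K u u) + (cmod q)\<^sup>2 * Re (sform A K v v)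
      + 2 * Re (p * cnj q * sform A K u v)"
proof -
  have "sform A K (\<lambda>i. p * u i + q * v i) (\<lambda>i. p * u i + q * v i) =
      p * cnj p * sform A K u u + q * cnj q * sform A K v v
       + (p * cnj q * sform A K u v + cnj (p * cnj q * sform A K u v))"
    using sform_cnj[OF assms, of v u]
    by (simp add: sform_add_left sform_add_right sform_scale_left sform_scale_right algebra_simps)
  also have "\<dots> = of_real ((cmod p)\<^sup>2) * of_real (Re (sform A K u u))
      + of_real ((cmod q)\<^sup>2) * of_real (Re (sform A K v v))
       + (p * cnj q * sform A K u v + cnj (p * cnj q * sform A K u v))"
    using sform_real[OF assms] by (metis complex_norm_square)
  finally have "Re (sform A K (\<lambda>i. p * u i + q * v i) (\<lambda>i. p * u i + q * v i)) = Re \<dots>"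
    by (rule arg_cong)
  moreover have "Re (of_real a * of_real b + of_real c * of_real d + (z + cnj z)) = a * b + c * d + 2 * Re z"
    for a b c d :: real and z by simp
  ultimately show ?thesis by metis
qed

text \<open>The form is only semidefinite, so the case of a null vector \<open>v\<close> is separate: there the quadratic
  inequality degenerates to a linear one that holds for every real factor.\<close>

lemma sform_Cauchy_Schwarz:
  assumes "psd_on A K"
  shows "(cmod (sform A K u v))\<^sup>2 \<le> Re (sform A K u u) * Re (sform A K v v)"
proof -
  define z where "z = sform A K u v"
  define P where "P = Re (sform A K u u)"
  define Q where "Q = Re (sform A K v v)"
  have *: "0 \<le> P + (s * cmod z)\<^sup>2 * Q - 2 * s * (cmod z)\<^sup>2" for s :: real
  proof -
    have "0 \<le> Re (sform A K (\<lambda>i. 1 * u i + (- (of_real s * z)) * v i)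
                  (\<lambda>i. 1 * u i + (- (of_real s * z)) * v i))"
      using assms by (rule psd_on_nonneg)
    also have "\<dots> = P + (s * cmod z)\<^sup>2 * Q + 2 * Re (1 * cnj (- (of_real s * z)) * z)"
      by (subst sform_comb[OF assms])
         (simp add: P_def Q_def z_def norm_mult power_mult_distrib)
    also have "Re (1 * cnj (- (of_real s * z)) * z) = - s * (cmod z)\<^sup>2"
    proof -
      have "1 * cnj (- (of_real s * z)) * z = - of_real s * (z * cnj z)" by simp
      also have "\<dots> = of_real (- s * (cmod z)\<^sup>2)"
        by (simp only: complex_norm_square of_real_mult of_real_minus)
      finally show ?thesis by (metis Re_complex_of_real)
    qed
    finally show ?thesis by (simp add: algebra_simps)
  qed
  have P: "P \<ge> 0" and Q: "Q \<ge> 0" using psd_on_nonneg[OF assms] by (auto simp: P_def Q_def)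
  show ?thesis
  proof (cases "Q = 0")
    case True
    have "(cmod z)\<^sup>2 = 0"
    proof (rule ccontr)
      assume "(cmod z)\<^sup>2 \<noteq> 0"
      then have "2 * ((P + 1) / (cmod z)\<^sup>2) * (cmod z)\<^sup>2 = 2 * (P + 1)" by simp
      with *[of "(P + 1) / (cmod z)\<^sup>2"] True P show False by simp
    qed
    with True show ?thesis by (simp add: z_def Q_def)
  next
    case False
    with Q have "Q > 0" by simp
    with *[of "1 / Q"] show ?thesis
      by (simp add: field_simps power2_eq_square flip: z_def P_def Q_def)
  qed
qed

lemma sform_null:
  assumes "psd_on A K" "Re (sform A K u u) = 0"
  shows "sform A K u v = 0"
  using sform_Cauchy_Schwarz[OF assms(1), of u v] assms(2) by simp

lemma sform_support:
  assumes "finite A" "B \<subseteq> A" "\<And>i. i \<in> A - B \<Longrightarrow> u i = 0" "\<And>i. i \<in> A - B \<Longrightarrow> v i = 0"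
  shows "sform A K u v = sform B K u v"
proof -
  have "sform A K u v = (\<Sum>i\<in>B. \<Sum>j\<in>A. u i * cnj (v j) * K i j)"
    unfolding sform_def using assms by (intro sum.mono_neutral_right) auto
  also have "\<dots> = sform B K u v"
    unfolding sform_def using assms by (intro sum.cong refl sum.mono_neutral_right) auto
  finally show ?thesis .
qed

lemma psd_on_subset:
  assumes "psd_on A K" "finite A" "B \<subseteq> A"
  shows "psd_on B K"
proof (rule psd_onI)
  fix u
  have "sform B K u u = sform B K (\<lambda>i. if i \<in> B then u i else 0) (\<lambda>i. if i \<in> B then u i else 0)"
    by (rule sform_cong) auto
  also have "\<dots> = sform A K (\<lambda>i. if i \<in> B then u i else 0) (\<lambda>i. if i \<in> B then u i else 0)"
    by (rule sform_support[symmetric]) (use assms in auto)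
  finally show "0 \<le> Re (sform B K u u)" using psd_on_nonneg[OF assms(1)] by simp
next
  fix i j assume "i \<in> B" "j \<in> B"
  then show "K j i = cnj (K i j)"
    using assms(3) psd_on_cnj[OF assms(1), of i j] by blast
qed

lemma psd_on_add: "psd_on A K \<Longrightarrow> psd_on A L \<Longrightarrow> psd_on A (\<lambda>i j. K i j + L i j)"
proof (rule psd_onI)
  assume K: "psd_on A K" and L: "psd_on A L"
  show "K j i + L j i = cnj (K i j + L i j)" if "i \<in> A" "j \<in> A" for i j
    using psd_on_cnj[OF K that] psd_on_cnj[OF L that] by simp
  have "sform A (\<lambda>i j. K i j + L i j) u u = sform A K u u + sform A L u u" for u
    by (simp add: sform_def sum.distrib algebra_simps)
  then show "0 \<le> Re (sform A (\<lambda>i j. K i j + L i j) u u)" for u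
    using psd_on_nonneg[OF K, of u] psd_on_nonneg[OF L, of u] by simp
qed

lemma psd_on_cong: "psd_on A K \<Longrightarrow> (\<And>i j. i \<in> A \<Longrightarrow> j \<in> A \<Longrightarrow> K i j = L i j) \<Longrightarrow> psd_on A L"
proof (rule psd_onI)
  assume K: "psd_on A K" and eq: "\<And>i j. i \<in> A \<Longrightarrow> j \<in> A \<Longrightarrow> K i j = L i j"
  show "L j i = cnj (L i j)" if "i \<in> A" "j \<in> A" for i j
    using psd_on_cnj[OF K that] eq[OF that] eq[OF that(2,1)] by simp
  have "sform A L u u = sform A K u u" for u
    by (rule sform_cong) (simp_all add: eq)
  then show "0 \<le> Re (sform A L u u)" for u
    using psd_on_nonneg[OF K, of u] by simp
qed

lemma psd_on_extend:
  assumes "psd_on B K" "finite A" "B \<subseteq> A"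
  shows "psd_on A (\<lambda>i j. if i \<in> B \<and> j \<in> B then K i j else 0)"
proof (rule psd_onI)
  fix u
  have "sform A (\<lambda>i j. if i \<in> B \<and> j \<in> B then K i j else 0) u u
     = sform A (\<lambda>i j. if i \<in> B \<and> j \<in> B then K i j else 0)
         (\<lambda>i. if i \<in> B then u i else 0) (\<lambda>i. if i \<in> B then u i else 0)"
    unfolding sform_def by (intro sum.cong refl) auto
  also have "\<dots> = sform B (\<lambda>i j. if i \<in> B \<and> j \<in> B then K i j else 0)
         (\<lambda>i. if i \<in> B then u i else 0) (\<lambda>i. if i \<in> B then u i else 0)"
    by (rule sform_support) (use assms in auto)
  also have "\<dots> = sform B K u u"
    by (rule sform_cong) auto
  finally show "0 \<le> Re (sform A (\<lambda>i j. if i \<in> B \<and> j \<in> B then K i j else 0) u u)"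
    using psd_on_nonneg[OF assms(1)] by simp
next
  fix i j
  show "(if j \<in> B \<and> i \<in> B then K j i else 0) = cnj (if i \<in> B \<and> j \<in> B then K i j else 0)"
    using psd_on_cnj[OF assms(1), of i j] by simp
qed

text \<open>Replacing each index \<open>i\<close> by the combination of the indices \<open>s\<close> with coefficients \<open>p i s\<close>: vectors
  of the pulled-back form are vectors of the original one.\<close>

lemma sform_pullback:
  assumes "finite A" "finite S"
  shows "sform A (\<lambda>i j. \<Sum>s\<in>S. \<Sum>t\<in>S. p i s * cnj (p j t) * K s t) u v
       = sform S K (\<lambda>s. \<Sum>i\<in>A. u i * p i s) (\<lambda>s. \<Sum>i\<in>A. v i * p i s)"
proof -
  have "sform S K (\<lambda>s. \<Sum>i\<in>A. u i * p i s) (\<lambda>s. \<Sum>i\<in>A. v i * p i s)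
     = (\<Sum>i\<in>A. \<Sum>j\<in>A. sform S K (\<lambda>s. u i * p i s) (\<lambda>s. v j * p j s))"
    by (simp add: sform_sum_left sform_sum_right)
  also have "\<dots> = (\<Sum>i\<in>A. \<Sum>j\<in>A. u i * cnj (v j) * sform S K (p i) (p j))"
    by (simp add: sform_scale_left sform_scale_right algebra_simps)
  finally show ?thesis by (simp add: sform_def)
qed

lemma psd_on_pullback:
  assumes "psd_on S K" "finite A" "finite S"
  shows "psd_on A (\<lambda>i j. \<Sum>s\<in>S. \<Sum>t\<in>S. p i s * cnj (p j t) * K s t)"
proof (rule psd_onI)
  show "0 \<le> Re (sform A (\<lambda>i j. \<Sum>s\<in>S. \<Sum>t\<in>S. p i s * cnj (p j t) * K s t) u u)" for u
    using assms by (simp add: sform_pullback psd_on_nonneg)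
  show "(\<Sum>s\<in>S. \<Sum>t\<in>S. p j s * cnj (p i t) * K s t) = cnj (\<Sum>s\<in>S. \<Sum>t\<in>S. p i s * cnj (p j t) * K s t)"
    for i j using sform_cnj[OF assms(1), of "p j" "p i"] by (simp add: sform_def)
qed

section \<open>Gluing positive semidefinite kernels\<close>

lemma sform_delta_right:
  assumes "finite A" "t \<in> A"
  shows "sform A K u (\<lambda>j. if j = t then 1 else 0) = (\<Sum>i\<in>A. u i * K i t)"
proof -
  have "(\<Sum>j\<in>A. u i * cnj (if j = t then 1 else 0) * K i j) = u i * K i t" for i
  proof -
    have "(\<Sum>j\<in>A. u i * cnj (if j = t then 1 else 0) * K i j) = (\<Sum>j\<in>A. if j = t then u i * K i j else 0)"
      by (intro sum.cong) auto
    then show ?thesis using assms by simp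
  qed
  then show ?thesis by (simp add: sform_def)
qed

lemma sum_delta_mult:
  fixes f :: "'i \<Rightarrow> complex"
  assumes "finite A" "t \<in> A"
  shows "(\<Sum>s\<in>A. (if s = t then 1 else 0) * f s) = f t"
proof -
  have "(\<Sum>s\<in>A. (if s = t then 1 else 0) * f s) = (\<Sum>s\<in>A. if s = t then f s else 0)"
    by (intro sum.cong) auto
  then show ?thesis using assms by simp
qed

lemma sform_delta_delta:
  assumes "finite A" "s \<in> A" "t \<in> A"
  shows "sform A K (\<lambda>i. if i = s then 1 else 0) (\<lambda>j. if j = t then 1 else 0) = K s t"
  using assms by (simp only: sform_delta_right sum_delta_mult)

text \<open>Orthogonal projection of the vector \<open>a\<close> onto the span of \<open>S\<close>, by Gram-Schmidt.  When a new vector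
  \<open>r\<close> is added to \<open>S\<close>, its component orthogonal to \<open>S\<close> may be a null vector of the form; then it is
  orthogonal to everything and the old projection still works.\<close>

lemma psd_on_projection:
  assumes "finite S" "psd_on (insert a S) K"
  shows "\<exists>\<pi>. \<forall>t\<in>S. K a t = (\<Sum>s\<in>S. \<pi> s * K s t)"
  using assms
proof (induction S arbitrary: a rule: finite_induct)
  case (insert r S)
  have fin: "finite (insert a (insert r S))" using insert.hyps by simp
  obtain \<alpha> where \<alpha>: "\<And>t. t \<in> S \<Longrightarrow> K a t = (\<Sum>s\<in>S. \<alpha> s * K s t)"
    using insert.IH[of a] psd_on_subset[OF insert.prems fin, of "insert a S"] by blast
  obtain \<beta> where \<beta>: "\<And>t. t \<in> S \<Longrightarrow> K r t = (\<Sum>s\<in>S. \<beta> s * K s t)"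
    using insert.IH[of r] psd_on_subset[OF insert.prems fin, of "insert r S"] by blast
  \<comment> \<open>pairings of \<open>r\<close> with the components of \<open>a\<close> and of \<open>r\<close> orthogonal to \<open>S\<close>\<close>
  define da where "da = K a r - (\<Sum>s\<in>S. \<alpha> s * K s r)"
  define dr where "dr = K r r - (\<Sum>s\<in>S. \<beta> s * K s r)"
  have null: "da = 0" if "dr = 0"
  proof -
    let ?A = "insert a (insert r S)"
    \<comment> \<open>\<open>u\<close> is the component of \<open>r\<close> orthogonal to \<open>S\<close>; its square norm is \<open>dr\<close>\<close>
    define u where "u = (\<lambda>i. if i = r then 1 else if i \<in> S then - \<beta> i else 0)"
    have col: "sform ?A K u (\<lambda>j. if j = t then 1 else 0) = K r t - (\<Sum>s\<in>S. \<beta> s * K s t)" if "t \<in> ?A" for t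
    proof -
      have "sform ?A K u (\<lambda>j. if j = t then 1 else 0) = (\<Sum>i\<in>?A. u i * K i t)"
        using fin that by (rule sform_delta_right)
      also have "\<dots> = (\<Sum>i\<in>insert r S. u i * K i t)"
        by (rule sum.mono_neutral_right) (use fin in \<open>auto simp: u_def\<close>)
      also have "\<dots> = K r t + (\<Sum>i\<in>S. u i * K i t)" using insert.hyps by (simp add: u_def)
      also have "(\<Sum>i\<in>S. u i * K i t) = (\<Sum>i\<in>S. - (\<beta> i * K i t))"
        using insert.hyps by (intro sum.cong) (auto simp: u_def)
      finally show ?thesis by (simp add: sum_negf)
    qed
    have colS: "sform ?A K u (\<lambda>j. if j = t then 1 else 0) = 0" if "t \<in> S" for t
      using col[of t] \<beta>[OF that] that by simp
    have colr: "sform ?A K u (\<lambda>j. if j = r then 1 else 0) = 0"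
      using col[of r] \<open>dr = 0\<close> by (simp add: dr_def)
    have "sform ?A K u u = sform ?A K u (\<lambda>i. \<Sum>k\<in>insert r S. u k * (if i = k then 1 else 0))"
    proof (rule sform_cong)
      fix i
      have "(\<Sum>k\<in>insert r S. u k * (if i = k then 1 else 0)) = (\<Sum>k\<in>insert r S. if i = k then u k else 0)"
        by (rule sum.cong) auto
      then show "u i = (\<Sum>k\<in>insert r S. u k * (if i = k then 1 else 0))"
        using insert.hyps by (auto simp: u_def)
    qed auto
    also have "\<dots> = (\<Sum>k\<in>insert r S. cnj (u k) * sform ?A K u (\<lambda>i. if i = k then 1 else 0))"
      by (simp only: sform_sum_right sform_scale_right)
    also have "\<dots> = 0" using colS colr by (intro sum.neutral) auto
    finally have "sform ?A K u (\<lambda>j. if j = a then 1 else 0) = 0"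
      using sform_null[OF insert.prems] by simp
    then have "K r a = (\<Sum>s\<in>S. \<beta> s * K s a)" using col[of a] by simp
    then have "cnj (K r a) = (\<Sum>s\<in>S. cnj (\<beta> s) * cnj (K s a))" by simp
    then have "K a r = (\<Sum>s\<in>S. cnj (\<beta> s) * K a s)"
    proof -
      have "cnj (K s a) = K a s" if "s \<in> S" for s
        using psd_on_cnj[OF insert.prems, of s a] that by simp
      then show ?thesis
        using \<open>cnj (K r a) = _\<close> psd_on_cnj[OF insert.prems, of r a] by simp
    qed
    also have "\<dots> = (\<Sum>s\<in>S. \<Sum>t\<in>S. cnj (\<beta> s) * (\<alpha> t * K t s))"
      by (intro sum.cong refl) (simp add: \<alpha> sum_distrib_left)
    also have "\<dots> = (\<Sum>t\<in>S. \<Sum>s\<in>S. cnj (\<beta> s) * (\<alpha> t * K t s))" by (rule sum.swap)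
    also have "\<dots> = (\<Sum>t\<in>S. \<alpha> t * cnj (\<Sum>s\<in>S. \<beta> s * K s t))"
    proof (intro sum.cong refl)
      fix t assume "t \<in> S"
      have "cnj (K s t) = K t s" if "s \<in> S" for s using psd_on_cnj[OF insert.prems, of s t] that \<open>t \<in> S\<close> by simp
      then show "(\<Sum>s\<in>S. cnj (\<beta> s) * (\<alpha> t * K t s)) = \<alpha> t * cnj (\<Sum>s\<in>S. \<beta> s * K s t)"
        by (simp add: sum_distrib_left mult_ac)
    qed
    also have "\<dots> = (\<Sum>t\<in>S. \<alpha> t * K t r)"
    proof (intro sum.cong refl)
      fix t assume "t \<in> S"
      have "cnj (K r t) = K t r" using psd_on_cnj[OF insert.prems, of r t] \<open>t \<in> S\<close> by simp
      then show "\<alpha> t * cnj (\<Sum>s\<in>S. \<beta> s * K s t) = \<alpha> t * K t r" using \<beta>[OF \<open>t \<in> S\<close>] by simp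
    qed
    finally show ?thesis by (simp add: da_def)
  qed
  define g where "g = da / dr"
  have g: "g * dr = da" using null by (cases "dr = 0") (auto simp: g_def)
  define \<pi> where "\<pi> s = (if s = r then g else \<alpha> s - g * \<beta> s)" for s
  have "(\<Sum>s\<in>insert r S. \<pi> s * K s t) = (\<Sum>s\<in>S. \<alpha> s * K s t) + g * (K r t - (\<Sum>s\<in>S. \<beta> s * K s t))" for t
  proof -
    have "(\<Sum>s\<in>insert r S. \<pi> s * K s t) = g * K r t + (\<Sum>s\<in>S. \<pi> s * K s t)"
      using insert.hyps by (simp add: \<pi>_def)
    also have "(\<Sum>s\<in>S. \<pi> s * K s t) = (\<Sum>s\<in>S. \<alpha> s * K s t - g * (\<beta> s * K s t))"
      using insert.hyps by (intro sum.cong) (auto simp: \<pi>_def algebra_simps)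
    finally show ?thesis by (simp add: sum_subtractf sum_distrib_left algebra_simps)
  qed
  then have "K a t = (\<Sum>s\<in>insert r S. \<pi> s * K s t)" if "t \<in> insert r S" for t
    using that \<alpha>[of t] \<beta>[of t] g by (auto simp: da_def dr_def)
  then show ?case by blast
qed simp

text \<open>Subtracting the projections onto the span of \<open>S\<close> leaves the Gram kernel of the components
  orthogonal to \<open>S\<close>.\<close>

lemma psd_on_Schur_complement:
  assumes "finite A" "finite S" "psd_on (A \<union> S) K"
  shows "\<exists>\<pi>. (\<forall>i\<in>A. \<forall>t\<in>S. K i t = (\<Sum>s\<in>S. \<pi> i s * K s t)) \<and>
     psd_on A (\<lambda>i j. K i j - (\<Sum>s\<in>S. \<Sum>t\<in>S. \<pi> i s * cnj (\<pi> j t) * K s t))"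
proof -
  have "\<exists>\<pi>. \<forall>t\<in>S. K i t = (\<Sum>s\<in>S. \<pi> s * K s t)" if "i \<in> A" for i
    by (rule psd_on_projection) (use assms that psd_on_subset[of "A \<union> S" K "insert i S"] in auto)
  then obtain \<pi> where \<pi>: "\<And>i t. i \<in> A \<Longrightarrow> t \<in> S \<Longrightarrow> K i t = (\<Sum>s\<in>S. \<pi> i s * K s t)"
    by metis
  define L where "L i j = (\<Sum>s\<in>S. \<Sum>t\<in>S. \<pi> i s * cnj (\<pi> j t) * K s t)" for i j
  have fin: "finite (A \<union> S)" using assms by simp
  have cn: "K j i = cnj (K i j)" if "i \<in> A \<union> S" "j \<in> A \<union> S" for i j
    using psd_on_cnj[OF assms(3) that] .
  have L1: "L i j = (\<Sum>s\<in>S. \<pi> i s * K s j)" if "i \<in> A" "j \<in> A" for i j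
  proof -
    have "L i j = (\<Sum>s\<in>S. \<pi> i s * (\<Sum>t\<in>S. cnj (\<pi> j t) * K s t))"
      by (simp add: L_def sum_distrib_left algebra_simps)
    also have "\<dots> = (\<Sum>s\<in>S. \<pi> i s * K s j)"
    proof (intro sum.cong refl)
      fix s assume s: "s \<in> S"
      have "cnj (K t s) = K s t" if "t \<in> S" for t using cn[of t s] that s by simp
      then have "(\<Sum>t\<in>S. cnj (\<pi> j t) * K s t) = cnj (\<Sum>t\<in>S. \<pi> j t * K t s)"
        by simp
      also have "\<dots> = cnj (K j s)" using \<pi>[OF that(2) s] by simp
      also have "\<dots> = K s j" using cn[of j s] s that by simp
      finally show "\<pi> i s * (\<Sum>t\<in>S. cnj (\<pi> j t) * K s t) = \<pi> i s * K s j" by simp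
    qed
    finally show ?thesis .
  qed
  have L2: "L i j = (\<Sum>t\<in>S. cnj (\<pi> j t) * K i t)" if "i \<in> A" "j \<in> A" for i j
  proof -
    have "L i j = (\<Sum>t\<in>S. \<Sum>s\<in>S. \<pi> i s * cnj (\<pi> j t) * K s t)"
      unfolding L_def by (rule sum.swap)
    also have "\<dots> = (\<Sum>t\<in>S. cnj (\<pi> j t) * (\<Sum>s\<in>S. \<pi> i s * K s t))"
      by (simp add: sum_distrib_left algebra_simps)
    also have "\<dots> = (\<Sum>t\<in>S. cnj (\<pi> j t) * K i t)"
      using \<pi>[OF that(1)] by simp
    finally show ?thesis .
  qed
  \<comment> \<open>the component of \<open>i\<close> orthogonal to \<open>S\<close>, as a combination of indices\<close>
  define \<rho> where "\<rho> i s = (if s = i then 1 else 0) - (if s \<in> S then \<pi> i s else 0)" for i s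
  have \<rho>_eq: "\<rho> i = (\<lambda>s. (if s = i then 1 else 0) + (-1) * (if s \<in> S then \<pi> i s else 0))" for i
    by (auto simp: \<rho>_def)
  have pb: "psd_on A (\<lambda>i j. \<Sum>s\<in>A\<union>S. \<Sum>t\<in>A\<union>S. \<rho> i s * cnj (\<rho> j t) * K s t)"
    using psd_on_pullback[OF assms(3,1) fin] .
  have "psd_on A (\<lambda>i j. K i j - L i j)"
  proof (rule psd_on_cong[OF pb])
    fix i j assume ij: "i \<in> A" "j \<in> A"
    have "(\<Sum>s\<in>A\<union>S. \<Sum>t\<in>A\<union>S. \<rho> i s * cnj (\<rho> j t) * K s t) = sform (A \<union> S) K (\<rho> i) (\<rho> j)"
      by (simp add: sform_def)
    also have "\<dots> = sform (A \<union> S) K (\<lambda>s. if s = i then 1 else 0) (\<lambda>s. if s = j then 1 else 0)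
       - sform (A \<union> S) K (\<lambda>s. if s = i then 1 else 0) (\<lambda>s. if s \<in> S then \<pi> j s else 0)
       - sform (A \<union> S) K (\<lambda>s. if s \<in> S then \<pi> i s else 0) (\<lambda>s. if s = j then 1 else 0)
       + sform (A \<union> S) K (\<lambda>s. if s \<in> S then \<pi> i s else 0) (\<lambda>s. if s \<in> S then \<pi> j s else 0)"
      (is "_ = ?dd - ?dp - ?pd + ?pp")
      by (simp only: \<rho>_eq sform_add_left sform_add_right sform_scale_left sform_scale_right) simp
    finally have expand: "(\<Sum>s\<in>A\<union>S. \<Sum>t\<in>A\<union>S. \<rho> i s * cnj (\<rho> j t) * K s t) = ?dd - ?dp - ?pd + ?pp" .
    note expand
    moreover have "sform (A \<union> S) K (\<lambda>s. if s = i then 1 else 0) (\<lambda>s. if s = j then 1 else 0) = K i j"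
      by (rule sform_delta_delta) (use ij fin in auto)
    moreover have "sform (A \<union> S) K (\<lambda>s. if s \<in> S then \<pi> i s else 0) (\<lambda>s. if s = j then 1 else 0) = L i j"
    proof -
      have "sform (A \<union> S) K (\<lambda>s. if s \<in> S then \<pi> i s else 0) (\<lambda>s. if s = j then 1 else 0)
         = (\<Sum>s\<in>A\<union>S. (if s \<in> S then \<pi> i s else 0) * K s j)"
        using ij fin by (simp add: sform_delta_right)
      also have "\<dots> = (\<Sum>s\<in>S. (if s \<in> S then \<pi> i s else 0) * K s j)"
        by (rule sum.mono_neutral_right) (use fin in auto)
      finally show ?thesis using L1[OF ij] by simp
    qed
    moreover have "sform (A \<union> S) K (\<lambda>s. if s = i then 1 else 0) (\<lambda>s. if s \<in> S then \<pi> j s else 0) = L i j"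
    proof -
      have "sform (A \<union> S) K (\<lambda>s. if s = i then 1 else 0) (\<lambda>s. if s \<in> S then \<pi> j s else 0)
         = cnj (sform (A \<union> S) K (\<lambda>s. if s \<in> S then \<pi> j s else 0) (\<lambda>s. if s = i then 1 else 0))"
        by (rule sform_cnj[OF assms(3)])
      also have "\<dots> = cnj (\<Sum>s\<in>A\<union>S. (if s \<in> S then \<pi> j s else 0) * K s i)"
        using ij fin by (simp add: sform_delta_right)
      also have "(\<Sum>s\<in>A\<union>S. (if s \<in> S then \<pi> j s else 0) * K s i) = (\<Sum>s\<in>S. (if s \<in> S then \<pi> j s else 0) * K s i)"
        by (rule sum.mono_neutral_right) (use fin in auto)
      also have "cnj \<dots> = (\<Sum>s\<in>S. cnj (\<pi> j s) * cnj (K s i))" by simp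
      also have "\<dots> = (\<Sum>s\<in>S. cnj (\<pi> j s) * K i s)"
      proof (intro sum.cong refl)
        fix s assume "s \<in> S"
        then show "cnj (\<pi> j s) * cnj (K s i) = cnj (\<pi> j s) * K i s" using cn[of s i] ij by simp
      qed
      also have "\<dots> = L i j" using L2[OF ij] by simp
      finally show ?thesis .
    qed
    moreover have "sform (A \<union> S) K (\<lambda>s. if s \<in> S then \<pi> i s else 0) (\<lambda>s. if s \<in> S then \<pi> j s else 0) = L i j"
    proof -
      have "sform (A \<union> S) K (\<lambda>s. if s \<in> S then \<pi> i s else 0) (\<lambda>s. if s \<in> S then \<pi> j s else 0)
        = sform S K (\<lambda>s. if s \<in> S then \<pi> i s else 0) (\<lambda>s. if s \<in> S then \<pi> j s else 0)"
        by (rule sform_support) (use fin in auto)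
      also have "\<dots> = sform S K (\<pi> i) (\<pi> j)" by (rule sform_cong) auto
      finally show ?thesis by (simp add: sform_def L_def)
    qed
    ultimately show "(\<Sum>s\<in>A\<union>S. \<Sum>t\<in>A\<union>S. \<rho> i s * cnj (\<rho> j t) * K s t) = K i j - L i j" by simp
  qed
  with \<pi> show ?thesis unfolding L_def by blast
qed

text \<open>The free amalgam of two families of vectors over a common subfamily \<open>S\<close>: keep the projections onto
  the span of \<open>S\<close> and make the components of \<open>A\<close> and of \<open>B\<close> orthogonal to \<open>S\<close> also orthogonal to each
  other.\<close>

lemma psd_on_glue:
  assumes fin: "finite A" "finite S" "finite B"
    and disj: "A \<inter> S = {}" "B \<inter> S = {}" "A \<inter> B = {}"
    and K1: "psd_on (A \<union> S) K1" and K2: "psd_on (B \<union> S) K2"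
    and eq: "\<And>s t. s \<in> S \<Longrightarrow> t \<in> S \<Longrightarrow> K1 s t = K2 s t"
  shows "\<exists>K. psd_on (A \<union> S \<union> B) K \<and> (\<forall>i\<in>A\<union>S. \<forall>j\<in>A\<union>S. K i j = K1 i j) \<and>
     (\<forall>i\<in>B\<union>S. \<forall>j\<in>B\<union>S. K i j = K2 i j)"
proof -
  obtain \<pi>1 where p1: "\<And>i t. i \<in> A \<Longrightarrow> t \<in> S \<Longrightarrow> K1 i t = (\<Sum>s\<in>S. \<pi>1 i s * K1 s t)"
    and s1: "psd_on A (\<lambda>i j. K1 i j - (\<Sum>s\<in>S. \<Sum>t\<in>S. \<pi>1 i s * cnj (\<pi>1 j t) * K1 s t))"
    using psd_on_Schur_complement[OF fin(1,2) K1] by blast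
  obtain \<pi>2 where p2: "\<And>i t. i \<in> B \<Longrightarrow> t \<in> S \<Longrightarrow> K2 i t = (\<Sum>s\<in>S. \<pi>2 i s * K2 s t)"
    and s2: "psd_on B (\<lambda>i j. K2 i j - (\<Sum>s\<in>S. \<Sum>t\<in>S. \<pi>2 i s * cnj (\<pi>2 j t) * K2 s t))"
    using psd_on_Schur_complement[OF fin(3,2) K2] by blast
  define \<pi> where "\<pi> i s = (if i \<in> A then \<pi>1 i s else if i \<in> B then \<pi>2 i s else if s = i then 1 else 0)" for i s
  \<comment> \<open>the Gram kernel of the projections onto the span of \<open>S\<close>\<close>
  define L where "L i j = (\<Sum>s\<in>S. \<Sum>t\<in>S. \<pi> i s * cnj (\<pi> j t) * K1 s t)" for i j
  define K where "K i j = L i j + (if i \<in> A \<and> j \<in> A then K1 i j - L i j else 0)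
      + (if i \<in> B \<and> j \<in> B then K2 i j - L i j else 0)" for i j
  have psdS: "psd_on S K1" using psd_on_subset[OF K1] fin by auto
  have finU: "finite (A \<union> S \<union> B)" using fin by simp
  have pL: "psd_on (A \<union> S \<union> B) L"
    unfolding L_def by (rule psd_on_pullback[OF psdS finU fin(2)])
  have pA: "psd_on A (\<lambda>i j. K1 i j - L i j)"
    by (rule psd_on_cong[OF s1]) (simp add: L_def \<pi>_def)
  have pB: "psd_on B (\<lambda>i j. K2 i j - L i j)"
  proof (rule psd_on_cong[OF s2])
    fix i j assume "i \<in> B" "j \<in> B"
    then have "i \<notin> A" "j \<notin> A" using disj by auto
    with \<open>i \<in> B\<close> \<open>j \<in> B\<close> show "K2 i j - (\<Sum>s\<in>S. \<Sum>t\<in>S. \<pi>2 i s * cnj (\<pi>2 j t) * K2 s t) = K2 i j - L i j"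
      by (simp add: L_def \<pi>_def eq)
  qed
  have pK: "psd_on (A \<union> S \<union> B) K"
    unfolding K_def
    by (intro psd_on_add pL psd_on_extend[OF pA finU] psd_on_extend[OF pB finU]) auto
  have LS: "L i t = (\<Sum>s\<in>S. \<pi> i s * K1 s t)" if "t \<in> S" for i t
  proof -
    have "t \<notin> A" "t \<notin> B" using that disj by auto
    then have "\<pi> t = (\<lambda>s. if s = t then 1 else 0)" by (auto simp: \<pi>_def)
    then have "L i t = sform S K1 (\<pi> i) (\<lambda>s. if s = t then 1 else 0)" by (simp add: L_def sform_def)
    then show ?thesis using sform_delta_right[OF fin(2) that] by simp
  qed
  have L_cnj: "L t i = cnj (L i t)" if "i \<in> A \<union> S \<union> B" "t \<in> A \<union> S \<union> B" for i t
    using psd_on_cnj[OF pL that] .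
  have LA: "L i t = K1 i t" if "i \<in> A \<union> S" "t \<in> S" for i t
  proof (cases "i \<in> A")
    case True
    then show ?thesis using LS[OF that(2), of i] p1[OF True that(2)] by (simp add: \<pi>_def)
  next
    case False
    then have "i \<in> S" "i \<notin> B" using that disj by auto
    then show ?thesis
      using LS[OF that(2), of i] False sum_delta_mult[OF fin(2) \<open>i \<in> S\<close>, of "\<lambda>s. K1 s t"]
      by (simp add: \<pi>_def)
  qed
  have LB: "L i t = K2 i t" if "i \<in> B \<union> S" "t \<in> S" for i t
  proof (cases "i \<in> B")
    case True
    then have "i \<notin> A" using disj by auto
    then show ?thesis using LS[OF that(2), of i] p2[OF True that(2)] True eq that by (simp add: \<pi>_def)
  next
    case False
    then have "i \<in> S" using that by auto
    then show ?thesis using LA[of i t] eq that by auto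
  qed
  have LA': "L t i = K1 t i" if "i \<in> A \<union> S" "t \<in> S" for i t
    using L_cnj[of i t] LA[OF that] psd_on_cnj[OF K1, of i t] that by auto
  have LB': "L t i = K2 t i" if "i \<in> B \<union> S" "t \<in> S" for i t
    using L_cnj[of i t] LB[OF that] psd_on_cnj[OF K2, of i t] that by auto
  have "K i j = K1 i j" if "i \<in> A \<union> S" "j \<in> A \<union> S" for i j
    using that disj LA[of i j] LA'[of j i] unfolding K_def by auto
  moreover have "K i j = K2 i j" if "i \<in> B \<union> S" "j \<in> B \<union> S" for i j
    using that disj LB[of i j] LB'[of j i] unfolding K_def by auto
  ultimately show ?thesis using pK by blast
qed

section \<open>Averaging over a cyclic group\<close>

lemma qform_scale: "qform A K (\<lambda>i. c * u i) = (cmod c)\<^sup>2 * qform A K u"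
proof -
  have "sform A K (\<lambda>i. c * u i) (\<lambda>i. c * u i) = of_real ((cmod c)\<^sup>2) * sform A K u u"
    by (simp only: complex_norm_square sform_scale_left sform_scale_right mult.assoc)
  then show ?thesis by simp
qed

lemma norm_add_squared_complex: "(cmod (z + w))\<^sup>2 = (cmod z)\<^sup>2 + (cmod w)\<^sup>2 + 2 * Re (z * cnj w)"
  unfolding cmod_power2 by (simp add: power2_eq_square algebra_simps)

lemma phase_exists: "\<exists>\<eta>. cmod \<eta> = 1 \<and> \<eta> * z = of_real (cmod z)"
proof (cases "z = 0")
  case True
  then show ?thesis by (intro exI[of _ 1]) simp
next
  case False
  have "cnj z / of_real (cmod z) * z = (z * cnj z) / of_real (cmod z)" by simp
  also have "\<dots> = of_real (cmod z)"
    using False by (simp add: power2_eq_square flip: complex_norm_square)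
  finally show ?thesis using False
    by (intro exI[of _ "cnj z / of_real (cmod z)"]) (simp add: norm_divide)
qed

text \<open>The norm bound for a scalar matrix extends to pairs of vectors of any semidefinite form: the form of
  the image depends on \<open>u\<close>, \<open>v\<close> only through their norms and their inner product, and by
  Cauchy-Schwarz the worst inner product is that of two numbers with suitable phases.\<close>

lemma toeplitz_bound_sform:
  assumes psd: "psd_on A K"
    and D: "\<And>\<xi> \<eta>. (cmod (p * \<xi> + q * \<eta>))\<^sup>2 + (cmod (p * \<eta>))\<^sup>2 \<le> D * ((cmod \<xi>)\<^sup>2 + (cmod \<eta>)\<^sup>2)"
  shows "qform A K (\<lambda>i. p * u i + q * v i) + qform A K (\<lambda>i. p * v i)
      \<le> D * (qform A K u + qform A K v)"
proof -
  define P where "P = qform A K u"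
  define Q where "Q = qform A K v"
  have PQ: "P \<ge> 0" "Q \<ge> 0" using psd_on_nonneg[OF psd] by (auto simp: P_def Q_def)
  \<comment> \<open>scalars with the norms of \<open>u\<close> and \<open>v\<close>, rotated so that the cross term is as large as possible\<close>
  obtain e where e: "cmod e = 1" "e * (p * cnj q) = of_real (cmod (p * cnj q))"
    using phase_exists by blast
  define \<xi> where "\<xi> = complex_of_real (sqrt P) * e"
  define \<eta> where "\<eta> = complex_of_real (sqrt Q)"
  have n: "(cmod \<xi>)\<^sup>2 = P" "(cmod \<eta>)\<^sup>2 = Q" using PQ e by (simp_all add: \<xi>_def \<eta>_def norm_mult)
  have "cmod (sform A K u v) \<le> sqrt P * sqrt Q"
    using real_sqrt_le_mono[OF sform_Cauchy_Schwarz[OF psd, of u v]]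
    by (simp add: P_def Q_def real_sqrt_mult)
  then have "cmod (p * cnj q * sform A K u v) \<le> cmod (p * cnj q) * (sqrt P * sqrt Q)"
    unfolding norm_mult[of "p * cnj q"] by (rule mult_left_mono) simp
  then have "Re (p * cnj q * sform A K u v) \<le> cmod (p * cnj q) * (sqrt P * sqrt Q)"
    using complex_Re_le_cmod[of "p * cnj q * sform A K u v"] by linarith
  also have "\<dots> = Re ((p * \<xi>) * cnj (q * \<eta>))"
  proof -
    have "(p * \<xi>) * cnj (q * \<eta>) = (e * (p * cnj q)) * (sqrt P * sqrt Q)"
      by (simp add: \<xi>_def \<eta>_def)
    also have "\<dots> = of_real (cmod (p * cnj q) * (sqrt P * sqrt Q))"
      unfolding e(2) by simp
    finally show ?thesis by (metis Re_complex_of_real)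
  qed
  finally have cross: "Re (p * cnj q * sform A K u v) \<le> Re ((p * \<xi>) * cnj (q * \<eta>))" .
  have "(cmod (p * \<xi> + q * \<eta>))\<^sup>2 = (cmod (p * \<xi>))\<^sup>2 + (cmod (q * \<eta>))\<^sup>2 + 2 * Re ((p * \<xi>) * cnj (q * \<eta>))"
    by (rule norm_add_squared_complex)
  also have "\<dots> = (cmod p)\<^sup>2 * P + (cmod q)\<^sup>2 * Q + 2 * Re ((p * \<xi>) * cnj (q * \<eta>))"
    by (simp add: norm_mult power_mult_distrib n)
  finally have "(cmod p)\<^sup>2 * P + (cmod q)\<^sup>2 * Q + 2 * Re ((p * \<xi>) * cnj (q * \<eta>)) + (cmod p)\<^sup>2 * Q \<le> D * (P + Q)"
    using D[of \<xi> \<eta>] by (simp add: norm_mult power_mult_distrib n)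
  then show ?thesis
    using cross sform_comb[OF psd, of p u q v] qform_scale[of A K p v]
    unfolding P_def[symmetric] Q_def[symmetric] by linarith
qed

definition root_unity :: "nat \<Rightarrow> nat \<Rightarrow> complex" where
  "root_unity M r = exp (2 * of_real pi * \<i> * of_nat r / of_nat M)"

lemma cmod_root_unity [simp]: "cmod (root_unity M r) = 1"
proof -
  have "root_unity M r = exp (\<i> * of_real (2 * pi * r / M))"
    by (simp add: root_unity_def algebra_simps)
  then show ?thesis using norm_exp_i_times by metis
qed

lemma root_unity_power: "root_unity M r ^ k = root_unity M (r * k)"
  by (simp add: root_unity_def exp_of_nat_mult[symmetric] algebra_simps)

lemma root_unity_eq_iff:
  "M > 0 \<Longrightarrow> root_unity M j = root_unity M k \<longleftrightarrow> j mod M = k mod M"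
  unfolding root_unity_def using complex_root_unity_eq[of M j k] by (simp add: Suc_le_eq)

lemma root_unity_mod: "M > 0 \<Longrightarrow> root_unity M r ^ (k mod M) = root_unity M r ^ k"
  by (simp add: root_unity_power root_unity_eq_iff mod_mult_right_eq)

lemma root_unity_cnj: "root_unity M r * cnj (root_unity M r) = 1"
proof -
  have "root_unity M r * cnj (root_unity M r) = of_real ((cmod (root_unity M r))\<^sup>2)"
    by (simp only: complex_norm_square)
  then show ?thesis by simp
qed

lemma root_unity_orthogonal:
  assumes "k < M" "l < M"
  shows "(\<Sum>r<M. root_unity M r ^ k * cnj (root_unity M r ^ l)) = (if k = l then of_nat M else 0)"
proof (cases "k = l")
  case True
  have "root_unity M r ^ l * cnj (root_unity M r ^ l) = 1" for r
    by (simp only: complex_cnj_power power_mult_distrib[symmetric] root_unity_cnj power_one)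
  then show ?thesis using True by simp
next
  case False
  have M: "M > 0" using assms by simp
  define z where "z = root_unity M k * cnj (root_unity M l)"
  have z_pow: "root_unity M r ^ k * cnj (root_unity M r ^ l) = z ^ r" for r
    by (simp add: z_def power_mult_distrib root_unity_power mult.commute flip: complex_cnj_power)
  have "z \<noteq> 1"
  proof
    assume "z = 1"
    then have "root_unity M k * (cnj (root_unity M l) * root_unity M l) = root_unity M l"
      by (simp add: z_def mult.assoc[symmetric])
    then have "root_unity M k = root_unity M l" using root_unity_cnj[of M l] by (simp add: mult.commute)
    then show False using root_unity_eq_iff[OF M] assms False by simp
  qed
  have "root_unity M (j * M) = 1" for j
    using root_unity_eq_iff[OF M, of "j * M" 0] by (simp add: root_unity_def)
  then have "z ^ M = 1"
    by (simp add: z_def power_mult_distrib root_unity_power flip: complex_cnj_power)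
  then have "(\<Sum>r<M. z ^ r) = 0" using \<open>z \<noteq> 1\<close> by (simp add: geometric_sum)
  then show ?thesis using False by (simp only: z_pow if_False)
qed

definition cyclic_transform :: "nat \<Rightarrow> nat \<Rightarrow> (nat \<Rightarrow> 'i \<Rightarrow> complex) \<Rightarrow> 'i \<Rightarrow> complex" where
  "cyclic_transform M r u = (\<lambda>i. \<Sum>k<M. root_unity M r ^ k * u k i)"

lemma cyclic_Parseval:
  "(\<Sum>r<M. qform A K (cyclic_transform M r u)) = M * (\<Sum>k<M. qform A K (u k))"
proof -
  have "(\<Sum>r<M. sform A K (cyclic_transform M r u) (cyclic_transform M r u)) =
     (\<Sum>r<M. \<Sum>k<M. \<Sum>l<M. (root_unity M r ^ k * cnj (root_unity M r ^ l)) * sform A K (u k) (u l))"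
    unfolding cyclic_transform_def
    by (simp only: sform_sum_left sform_sum_right sform_scale_left sform_scale_right sum_distrib_left mult.assoc)
  also have "\<dots> = (\<Sum>k<M. \<Sum>r<M. \<Sum>l<M. (root_unity M r ^ k * cnj (root_unity M r ^ l)) * sform A K (u k) (u l))"
    by (rule sum.swap)
  also have "\<dots> = (\<Sum>k<M. \<Sum>l<M. \<Sum>r<M. (root_unity M r ^ k * cnj (root_unity M r ^ l)) * sform A K (u k) (u l))"
    by (intro sum.cong refl sum.swap)
  also have "\<dots> = (\<Sum>k<M. \<Sum>l<M. if k = l then of_nat M * sform A K (u k) (u l) else 0)"
    by (intro sum.cong refl, simp only: sum_distrib_right[symmetric] root_unity_orthogonal lessThan_iff) simp
  also have "\<dots> = of_nat M * (\<Sum>k<M. sform A K (u k) (u k))"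
    by (simp add: sum_distrib_left)
  finally have "Re (\<Sum>r<M. sform A K (cyclic_transform M r u) (cyclic_transform M r u))
     = Re (of_real (real M) * (\<Sum>k<M. sform A K (u k) (u k)))" by simp
  then show ?thesis by simp
qed

lemma cyclic_transform_shift:
  assumes "M > 0"
  shows "cyclic_transform M r (\<lambda>k. u (Suc k mod M)) = (\<lambda>i. cnj (root_unity M r) * cyclic_transform M r u i)"
proof
  fix i
  have "cyclic_transform M r (\<lambda>k. u (Suc k mod M)) i =
     (\<Sum>k<M. cnj (root_unity M r) * (root_unity M r ^ (Suc k mod M) * u (Suc k mod M) i))"
    unfolding cyclic_transform_def
  proof (intro sum.cong refl)
    fix k
    have "cnj (root_unity M r) * root_unity M r ^ (Suc k mod M) =
        (root_unity M r * cnj (root_unity M r)) * root_unity M r ^ k"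
      using root_unity_mod[OF assms, of r "Suc k"] by simp
    then show "root_unity M r ^ k * u (Suc k mod M) i =
        cnj (root_unity M r) * (root_unity M r ^ (Suc k mod M) * u (Suc k mod M) i)"
      by (simp add: root_unity_cnj mult.assoc[symmetric])
  qed
  also have "\<dots> = (\<Sum>k<M. cnj (root_unity M r) * (root_unity M r ^ k * u k i))"
  proof (rule sum.reindex_bij_witness[of _ "\<lambda>k. (k + (M - 1)) mod M" "\<lambda>k. Suc k mod M"])
    fix k assume "k \<in> {..<M}"
    then show "Suc ((k + (M - 1)) mod M) mod M = k"
      using assms by (simp add: mod_Suc_eq)
    from \<open>k \<in> {..<M}\<close> show "(Suc k mod M + (M - 1)) mod M = k"
      using assms by (cases "Suc k = M") auto
  qed (use assms in auto)
  finally show "cyclic_transform M r (\<lambda>k. u (Suc k mod M)) i = cnj (root_unity M r) * cyclic_transform M r u i"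
    by (simp add: cyclic_transform_def sum_distrib_left)
qed

lemma cyclic_transform_add:
  "cyclic_transform M r (\<lambda>k i. u k i + v k i) = (\<lambda>i. cyclic_transform M r u i + cyclic_transform M r v i)"
  by (simp add: cyclic_transform_def algebra_simps sum.distrib)

lemma cyclic_transform_scale:
  "cyclic_transform M r (\<lambda>k i. c * u k i) = (\<lambda>i. c * cyclic_transform M r u i)"
  by (simp add: cyclic_transform_def algebra_simps sum_distrib_left)

text \<open>The cyclic shift becomes multiplication by \<open>cnj (root_unity M r)\<close> under the transform, so at each
  frequency the left side is the form of a scalar matrix applied to a pair of vectors.\<close>

lemma cyclic_toeplitz_bound:
  fixes u v :: "nat \<Rightarrow> 'i \<Rightarrow> complex"
  assumes psd: "psd_on A K" and M: "M > 0"
    and D: "\<And>t \<xi> \<eta>. cmod t = 1 \<Longrightarrow>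
      (cmod ((a + b * t) * \<xi> + (c0 + c1 * t + c2 * t\<^sup>2) * \<eta>))\<^sup>2 + (cmod ((a + b * t) * \<eta>))\<^sup>2
        \<le> D * ((cmod \<xi>)\<^sup>2 + (cmod \<eta>)\<^sup>2)"
  defines "s \<equiv> (\<lambda>k. Suc k mod M)"
  shows "(\<Sum>k<M. qform A K (\<lambda>i. a * u k i + b * u (s k) i + c0 * v k i + c1 * v (s k) i + c2 * v (s (s k)) i)
               + qform A K (\<lambda>i. a * v k i + b * v (s k) i))
         \<le> D * (\<Sum>k<M. qform A K (u k) + qform A K (v k))"
proof -
  let ?T = "cyclic_transform M"
  let ?w = "\<lambda>k i. a * u k i + b * u (s k) i + c0 * v k i + c1 * v (s k) i + c2 * v (s (s k)) i"
  let ?z = "\<lambda>k i. a * v k i + b * v (s k) i"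
  have shift: "?T r (\<lambda>k i. x (s k) i) = (\<lambda>i. cnj (root_unity M r) * ?T r x i)" for r and x :: "nat \<Rightarrow> 'i \<Rightarrow> complex"
    using cyclic_transform_shift[OF M, of r x] by (simp add: s_def)
  have bound: "qform A K (?T r ?w) + qform A K (?T r ?z) \<le> D * (qform A K (?T r u) + qform A K (?T r v))" for r
  proof -
    let ?t = "cnj (root_unity M r)"
    have "?T r ?w = (\<lambda>i. (a + b * ?t) * ?T r u i + (c0 + c1 * ?t + c2 * ?t\<^sup>2) * ?T r v i)"
      using shift[of r "\<lambda>k. v (s k)"]
      by (simp add: cyclic_transform_add cyclic_transform_scale shift algebra_simps power2_eq_square)
    moreover have "?T r ?z = (\<lambda>i. (a + b * ?t) * ?T r v i)"
      by (simp add: cyclic_transform_add cyclic_transform_scale shift algebra_simps)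
    ultimately show ?thesis
      using toeplitz_bound_sform[OF psd D, of ?t "?T r u" "?T r v"] by simp
  qed
  have "real M * (\<Sum>k<M. qform A K (?w k) + qform A K (?z k))
     = (\<Sum>r<M. qform A K (?T r ?w) + qform A K (?T r ?z))"
    using cyclic_Parseval[of A K M ?w] cyclic_Parseval[of A K M ?z] by (simp add: sum.distrib algebra_simps)
  also have "\<dots> \<le> (\<Sum>r<M. D * (qform A K (?T r u) + qform A K (?T r v)))"
    by (intro sum_mono bound)
  also have "\<dots> = real M * (D * (\<Sum>k<M. qform A K (u k) + qform A K (v k)))"
    using cyclic_Parseval[of A K M u] cyclic_Parseval[of A K M v]
    by (simp add: sum.distrib algebra_simps flip: sum_distrib_left)
  finally show ?thesis using M by simp
qed

section \<open>Stationary extensions of a window\<close>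

type_synonym site = "bool \<times> nat"

text \<open>The site \<open>(False, k)\<close> stands for \<open>x\<^sub>k\<close> and \<open>(True, k)\<close> for \<open>y\<^sub>k\<close>.  The \<open>y\<close>-sites reach one step further
  because \<open>y\<close> meets the second-order term; \<open>sites 1\<close> is the window of the five vectors, and \<open>sites 0\<close>
  is the part that a window shares with the next one, up to a shift.\<close>

definition sites :: "nat \<Rightarrow> site set" where
  "sites N = {(c, k). k \<le> N \<or> c \<and> k = Suc N}"

definition shift :: "nat \<Rightarrow> site \<Rightarrow> site" where
  "shift n i = (fst i, snd i + n)"

lemma finite_sites [simp]: "finite (sites N)"
proof (rule finite_subset)
  show "sites N \<subseteq> UNIV \<times> {..N + 1}" by (auto simp: sites_def)
qed simp

lemma sites_0: "sites 0 = {(False, 0), (True, 0), (True, 1)}"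
  by (auto simp: sites_def le_Suc_eq split: if_splits)

lemma sites_1: "sites 1 = {(False, 0), (False, 1), (True, 0), (True, 1), (True, 2)}"
  by (auto simp: sites_def le_Suc_eq numeral_2_eq_2 split: if_splits)

lemma shift_shift [simp]: "shift m (shift n i) = shift (m + n) i"
  by (simp add: shift_def)

lemma shift_zero [simp]: "shift 0 i = i"
  by (simp add: shift_def)

lemma shift_sites: "i \<in> sites m \<Longrightarrow> shift n i \<in> sites (m + n)"
  by (auto simp: sites_def shift_def)

lemma inj_shift: "inj_on (shift n) A"
  by (auto simp: inj_on_def shift_def)

lemma psd_on_reindex:
  assumes "psd_on W K" "\<And>i. i \<in> W \<Longrightarrow> h (g i) = i"
  shows "psd_on (g ` W) (\<lambda>i j. K (h i) (h j))"
proof (rule psd_onI)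
  have inj: "inj_on g W" using assms(2) by (metis inj_onI)
  fix u
  have "sform (g ` W) (\<lambda>i j. K (h i) (h j)) u u = sform W K (\<lambda>i. u (g i)) (\<lambda>i. u (g i))"
    unfolding sform_def using assms(2) by (simp add: sum.reindex[OF inj])
  then show "0 \<le> Re (sform (g ` W) (\<lambda>i j. K (h i) (h j)) u u)"
    using psd_on_nonneg[OF assms(1)] by simp
next
  fix i j assume "i \<in> g ` W" "j \<in> g ` W"
  then show "K (h j) (h i) = cnj (K (h i) (h j))"
    using psd_on_cnj[OF assms(1), of "h i" "h j"] assms(2) by auto
qed

lemma sites_Suc: "sites (Suc N) = (sites N - shift N ` sites 0) \<union> shift N ` sites 0 \<union> {(False, Suc N), (True, N + 2)}"
  unfolding sites_0 by (auto simp: sites_def shift_def split: if_splits)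

lemma shift_sites_1: "shift N ` sites 1 = {(False, Suc N), (True, N + 2)} \<union> shift N ` sites 0"
  unfolding sites_0 sites_1 by (auto simp: shift_def)

text \<open>A chain of windows, glued one after the other: the kernel built so far and the next window meet in a
  shifted copy of \<open>sites 0\<close>, where they agree because the window is stationary.\<close>

lemma stationary_extension:
  assumes psd: "psd_on (sites 1) K0"
    and inv: "\<And>i j. i \<in> sites 0 \<Longrightarrow> j \<in> sites 0 \<Longrightarrow> K0 (shift 1 i) (shift 1 j) = K0 i j"
  shows "\<exists>K. psd_on (sites N) K \<and>
    (\<forall>k<N. \<forall>i\<in>sites 1. \<forall>j\<in>sites 1. K (shift k i) (shift k j) = K0 i j) \<and>
    (\<forall>i\<in>sites 0. \<forall>j\<in>sites 0. K (shift N i) (shift N j) = K0 i j)"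
proof (induction N)
  case 0
  have "sites 0 \<subseteq> sites 1" by (auto simp: sites_def)
  then show ?case using psd_on_subset[OF psd] by (intro exI[of _ K0]) auto
next
  case (Suc N)
  then obtain K1 where psd1: "psd_on (sites N) K1"
    and win: "\<And>k i j. k < N \<Longrightarrow> i \<in> sites 1 \<Longrightarrow> j \<in> sites 1 \<Longrightarrow> K1 (shift k i) (shift k j) = K0 i j"
    and top: "\<And>i j. i \<in> sites 0 \<Longrightarrow> j \<in> sites 0 \<Longrightarrow> K1 (shift N i) (shift N j) = K0 i j"
    by blast
  \<comment> \<open>the inverse of \<open>shift N\<close> on its image\<close>
  define h :: "site \<Rightarrow> site" where "h i = (fst i, snd i - N)" for i
  have h: "h (shift N i) = i" for i by (simp add: h_def shift_def)
  define S where "S = shift N ` sites 0"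
  define A where "A = sites N - S"
  define B :: "site set" where "B = {(False, Suc N), (True, N + 2)}"
  have SN: "S \<subseteq> sites N" using shift_sites[of _ 0 N] by (auto simp: S_def)
  have AS: "A \<union> S = sites N" using SN by (auto simp: A_def)
  have BS: "B \<union> S = shift N ` sites 1" unfolding B_def S_def by (rule shift_sites_1[symmetric])
  have ASB: "A \<union> S \<union> B = sites (Suc N)" unfolding A_def B_def S_def by (rule sites_Suc[symmetric])
  have B_new: "B \<inter> sites N = {}" by (auto simp: B_def sites_def)
  have "\<exists>K. psd_on (A \<union> S \<union> B) K \<and> (\<forall>i\<in>A\<union>S. \<forall>j\<in>A\<union>S. K i j = K1 i j) \<and>
     (\<forall>i\<in>B\<union>S. \<forall>j\<in>B\<union>S. K i j = K0 (h i) (h j))"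
  proof (rule psd_on_glue)
    show "psd_on (A \<union> S) K1" using psd1 by (simp add: AS)
    show "psd_on (B \<union> S) (\<lambda>i j. K0 (h i) (h j))"
      unfolding BS by (rule psd_on_reindex[OF psd]) (simp add: h)
    show "K1 s t = K0 (h s) (h t)" if "s \<in> S" "t \<in> S" for s t
      using that top by (auto simp: S_def h)
  qed (use SN B_new in \<open>auto simp: A_def S_def B_def\<close>)
  then obtain K where K: "psd_on (sites (Suc N)) K"
    and K1: "\<And>i j. i \<in> sites N \<Longrightarrow> j \<in> sites N \<Longrightarrow> K i j = K1 i j"
    and K2: "\<And>i j. i \<in> shift N ` sites 1 \<Longrightarrow> j \<in> shift N ` sites 1 \<Longrightarrow> K i j = K0 (h i) (h j)"
    unfolding ASB unfolding AS BS by blast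
  have winN: "K (shift N i) (shift N j) = K0 i j" if "i \<in> sites 1" "j \<in> sites 1" for i j
    using K2 that by (simp add: h)
  have "K (shift k i) (shift k j) = K0 i j" if "k < Suc N" "i \<in> sites 1" "j \<in> sites 1" for k i j
  proof (cases "k = N")
    case True
    then show ?thesis using winN that by simp
  next
    case False
    then have "k < N" using that by simp
    have "sites (1 + k) \<subseteq> sites N" using \<open>k < N\<close> by (auto simp: sites_def)
    then have "shift k i \<in> sites N" "shift k j \<in> sites N" using shift_sites that by blast+
    then show ?thesis using K1 win[OF \<open>k < N\<close> that(2,3)] by simp
  qed
  moreover have "K (shift (Suc N) i) (shift (Suc N) j) = K0 i j" if "i \<in> sites 0" "j \<in> sites 0" for i j
    using winN[of "shift 1 i" "shift 1 j"] inv[OF that] shift_sites[of i 0 1] shift_sites[of j 0 1] that by simp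
  ultimately show ?case using K by blast
qed

text \<open>A chain of \<open>N\<close> windows, closed up to a cycle of length \<open>N + 2\<close>.  The \<open>N\<close> windows inside the chain
  contribute the left side each; the two windows that wrap around contribute nonnegative amounts.
  So \<open>N\<close> times the left side is at most \<open>N + 2\<close> times the right side.\<close>

lemma stationary_toeplitz_bound:
  fixes a b c0 c1 c2 :: complex
  assumes psd: "psd_on (sites 1) K0"
    and inv: "\<And>i j. i \<in> sites 0 \<Longrightarrow> j \<in> sites 0 \<Longrightarrow> K0 (shift 1 i) (shift 1 j) = K0 i j"
    and D: "\<And>t \<xi> \<eta>. cmod t = 1 \<Longrightarrow>
      (cmod ((a + b * t) * \<xi> + (c0 + c1 * t + c2 * t\<^sup>2) * \<eta>))\<^sup>2 + (cmod ((a + b * t) * \<eta>))\<^sup>2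
        \<le> D * ((cmod \<xi>)\<^sup>2 + (cmod \<eta>)\<^sup>2)"
  defines "upper \<equiv> (\<lambda>(c, k). if c then (if k = 0 then c0 else if k = 1 then c1 else c2) else (if k = 0 then a else b))"
    and "lower \<equiv> (\<lambda>(c, k). if c then (if k = 0 then a else if k = 1 then b else 0) else 0)"
  shows "qform (sites 1) K0 upper + qform (sites 1) K0 lower \<le> D * (Re (K0 (False, 0) (False, 0)) + Re (K0 (True, 0) (True, 0)))"
proof -
  let ?q = "qform (sites 1) K0 upper + qform (sites 1) K0 lower"
  define Kx where "Kx = Re (K0 (False, 0) (False, 0))"
  define Ky where "Ky = Re (K0 (True, 0) (True, 0))"
  have D0: "D \<ge> 0"
  proof -
    have "0 \<le> (cmod ((a + b * 1) * 1 + (c0 + c1 * 1 + c2 * 1\<^sup>2) * 0))\<^sup>2 + (cmod ((a + b * 1) * 0))\<^sup>2" by simp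
    also have "\<dots> \<le> D" using D[of 1 1 0] by simp
    finally show ?thesis .
  qed
  have mem: "(False, 0) \<in> sites 0" "(True, 0) \<in> sites 0" "(True, 1) \<in> sites 0" "sites 0 \<subseteq> sites 1"
    by (auto simp: sites_def)
  have diag: "0 \<le> Re (K0 i i)" if "i \<in> sites 1" for i
    using psd_on_nonneg[OF psd, of "\<lambda>j. if j = i then 1 else 0"] sform_delta_delta[OF finite_sites that that, of K0] by simp
  have Kpos: "0 \<le> Kx" "0 \<le> Ky" using diag mem by (auto simp: Kx_def Ky_def)
  have main: "real N * ?q \<le> (real N + 2) * (D * (Kx + Ky))" for N
  proof -
    obtain K where psdK: "psd_on (sites N) K"
      and win: "\<And>k i j. k < N \<Longrightarrow> i \<in> sites 1 \<Longrightarrow> j \<in> sites 1 \<Longrightarrow> K (shift k i) (shift k j) = K0 i j"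
      and top: "\<And>i j. i \<in> sites 0 \<Longrightarrow> j \<in> sites 0 \<Longrightarrow> K (shift N i) (shift N j) = K0 i j"
      using stationary_extension[of K0 N, OF psd] inv by metis
    define M where "M = N + 2"
    define s where "s k = Suc k mod M" for k
    \<comment> \<open>the cycle has one \<open>y\<close>-site more than \<open>x\<close>-sites; the missing \<open>x\<close>-vector is zero\<close>
    define u where "u k = (\<lambda>i :: site. if i = (False, k) \<and> k \<le> N then 1 else 0 :: complex)" for k
    define v where "v k = (\<lambda>i :: site. if i = (True, k) then 1 else 0 :: complex)" for k
    define U where "U k = (\<lambda>i. a * u k i + b * u (s k) i + c0 * v k i + c1 * v (s k) i + c2 * v (s (s k)) i)" for k
    define L where "L k = (\<lambda>i. a * v k i + b * v (s k) i)" for k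
    have bound: "(\<Sum>k<M. qform (sites N) K (U k) + qform (sites N) K (L k))
        \<le> D * (\<Sum>k<M. qform (sites N) K (u k) + qform (sites N) K (v k))"
      unfolding U_def L_def s_def by (rule cyclic_toeplitz_bound[OF psdK _ D]) (simp_all add: M_def)
    have shifted: "qform (sites N) K w = qform (sites 1) K0 w0"
      if "k < N" and w: "\<And>i. i \<in> sites 1 \<Longrightarrow> w (shift k i) = w0 i" and z: "\<And>i. i \<in> sites N - shift k ` sites 1 \<Longrightarrow> w i = 0"
      for k w w0
    proof -
      have "sites (1 + k) \<subseteq> sites N" using that(1) by (auto simp: sites_def)
      then have sub: "shift k ` sites 1 \<subseteq> sites N" using shift_sites by blast
      have "sform (sites N) K w w = sform (shift k ` sites 1) K w w"
        by (rule sform_support) (use sub z in auto)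
      also have "\<dots> = sform (sites 1) (\<lambda>i j. K (shift k i) (shift k j)) (\<lambda>i. w (shift k i)) (\<lambda>i. w (shift k i))"
        by (simp add: sform_def sum.reindex[OF inj_shift])
      also have "\<dots> = sform (sites 1) K0 w0 w0"
        by (rule sform_cong) (use w win[OF that(1)] in auto)
      finally show ?thesis by simp
    qed
    have sk: "s k = Suc k" "s (Suc k) = Suc (Suc k)" if "k < N" for k
      using that by (auto simp: s_def M_def)
    have UL: "qform (sites N) K (U k) + qform (sites N) K (L k) = ?q" if "k < N" for k
    proof -
      have "qform (sites N) K (U k) = qform (sites 1) K0 upper"
        by (rule shifted[OF that])
           (use that in \<open>auto simp: sites_1[simplified] numeral_2_eq_2 U_def u_def v_def sk shift_def upper_def\<close>)
      moreover have "qform (sites N) K (L k) = qform (sites 1) K0 lower"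
        by (rule shifted[OF that])
           (use that in \<open>auto simp: sites_1[simplified] numeral_2_eq_2 L_def u_def v_def sk shift_def lower_def\<close>)
      ultimately show ?thesis by simp
    qed
    have "real N * ?q = (\<Sum>k<N. qform (sites N) K (U k) + qform (sites N) K (L k))"
      using UL by simp
    also have "\<dots> \<le> (\<Sum>k<M. qform (sites N) K (U k) + qform (sites N) K (L k))"
      by (rule sum_mono2) (use psd_on_nonneg[OF psdK] in \<open>auto simp: M_def\<close>)
    also have "\<dots> \<le> D * (\<Sum>k<M. qform (sites N) K (u k) + qform (sites N) K (v k))" by (rule bound)
    also have "\<dots> \<le> D * (\<Sum>k<M. Kx + Ky)"
    proof (intro mult_left_mono sum_mono add_mono D0)
      fix k assume k: "k \<in> {..<M}"
      show "qform (sites N) K (u k) \<le> Kx"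
      proof (cases "k \<le> N")
        case True
        have "(False, k) \<in> sites N" using True by (simp add: sites_def)
        then have "sform (sites N) K (u k) (u k) = K (False, k) (False, k)"
          using True sform_delta_delta[of "sites N" "(False, k)" "(False, k)" K] by (simp add: u_def)
        also have "\<dots> = K0 (False, 0) (False, 0)"
        proof (cases "k = N")
          case True
          then show ?thesis using top[of "(False, 0)" "(False, 0)"] mem by (simp add: shift_def)
        next
          case False
          then show ?thesis using win[of k "(False, 0)" "(False, 0)"] \<open>k \<le> N\<close> mem by (auto simp add: shift_def)
        qed
        finally show ?thesis by (simp add: Kx_def)
      next
        case False
        then show ?thesis using Kpos by (simp add: u_def sform_def)
      qed
      have "(True, k) \<in> sites N" using k by (auto simp: sites_def M_def less_Suc_eq_le le_Suc_eq)
      then have "sform (sites N) K (v k) (v k) = K (True, k) (True, k)"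
        using sform_delta_delta[of "sites N" "(True, k)" "(True, k)" K] by (simp add: v_def)
      also have "\<dots> = K0 (True, 0) (True, 0)"
      proof -
        consider "k < N" | "k = N" | "k = Suc N" using k by (fastforce simp: M_def)
        then show ?thesis
        proof cases
          case 1
          then show ?thesis using win[of k "(True, 0)" "(True, 0)"] mem by (auto simp add: shift_def)
        next
          case 2
          then show ?thesis using top[of "(True, 0)" "(True, 0)"] mem by (simp add: shift_def)
        next
          case 3
          then show ?thesis using top[of "(True, 1)" "(True, 1)"] inv[of "(True, 0)" "(True, 0)"] mem
            by (simp add: shift_def)
        qed
      qed
      finally show "qform (sites N) K (v k) \<le> Ky" by (simp add: Ky_def)
    qed
    also have "\<dots> = (real N + 2) * (D * (Kx + Ky))" by (simp add: M_def algebra_simps)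
    finally show ?thesis .
  qed
  have "?q \<le> D * (Kx + Ky)"
  proof (rule LIMSEQ_le_const)
    have "(\<lambda>N. (real (Suc N) + 2) / real (Suc N) * (D * (Kx + Ky))) \<longlonglongrightarrow> 1 * (D * (Kx + Ky))"
      by (intro tendsto_mult tendsto_const) real_asymp
    then show "(\<lambda>N. (real (Suc N) + 2) / real (Suc N) * (D * (Kx + Ky))) \<longlonglongrightarrow> D * (Kx + Ky)" by simp
    show "\<exists>N. \<forall>n\<ge>N. ?q \<le> (real (Suc n) + 2) / real (Suc n) * (D * (Kx + Ky))"
    proof (intro exI[of _ 0] allI impI)
      fix n
      show "?q \<le> (real (Suc n) + 2) / real (Suc n) * (D * (Kx + Ky))"
        using main[of "Suc n"] by (simp add: pos_le_divide_eq mult.commute del: of_nat_Suc)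
    qed
  qed
  then show ?thesis by (simp add: Kx_def Ky_def)
qed

section \<open>Commuting contractions\<close>

lemma complex_ring_simps [simp]:
  "carrier complex_ring = UNIV" "mult complex_ring = (*)" "one complex_ring = 1"
  "zero complex_ring = 0" "add complex_ring = (+)"
  by (simp_all add: complex_ring_def)

lemma psd_on_diagonal:
  assumes "finite A" "\<And>i. i \<in> A \<Longrightarrow> 0 \<le> w i"
  shows "psd_on A (\<lambda>i j. if i = j then complex_of_real (w i) else 0)"
proof (rule psd_onI)
  fix u
  have "sform A (\<lambda>i j. if i = j then complex_of_real (w i) else 0) u u
     = (\<Sum>i\<in>A. \<Sum>j\<in>A. if i = j then of_real ((cmod (u i))\<^sup>2 * w i) else 0)"
    unfolding sform_def by (intro sum.cong refl) (simp only: complex_norm_square of_real_mult split: if_split, simp)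
  also have "\<dots> = of_real (\<Sum>i\<in>A. (cmod (u i))\<^sup>2 * w i)"
    using assms(1) by simp
  finally show "0 \<le> Re (sform A (\<lambda>i j. if i = j then complex_of_real (w i) else 0) u u)"
    by (simp add: assms(2) sum_nonneg)
qed auto

lemma op_norm_le:
  assumes "\<And>x. x \<in> carrier H \<Longrightarrow> hnorm H (A x) \<le> r * hnorm H x" "0 \<le> r"
  shows "op_norm H A \<le> ereal r"
  unfolding op_norm_def
proof (rule SUP_least)
  fix x assume x: "x \<in> {x \<in> carrier H. hnorm H x \<le> 1}"
  then have "hnorm H (A x) \<le> r * hnorm H x" using assms(1) by simp
  also have "\<dots> \<le> r" using x assms(2) mult_left_le by auto
  finally show "ereal (hnorm H (A x)) \<le> ereal r" by simp
qed

lemma op_norm_bound: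
  assumes smult: "\<And>c x. x \<in> carrier H \<Longrightarrow> c \<odot>\<^bsub>H\<^esub> x \<in> carrier H"
    and norm: "\<And>c x. x \<in> carrier H \<Longrightarrow> hnorm H (c \<odot>\<^bsub>H\<^esub> x) = cmod c * hnorm H x"
    and A: "\<And>c x. x \<in> carrier H \<Longrightarrow> A (c \<odot>\<^bsub>H\<^esub> x) = c \<odot>\<^bsub>H\<^esub> A x" "\<And>x. x \<in> carrier H \<Longrightarrow> A x \<in> carrier H"
    and r: "op_norm H A \<le> ereal r" and x: "x \<in> carrier H" "hnorm H x > 0"
  shows "hnorm H (A x) \<le> r * hnorm H x"
proof -
  let ?c = "complex_of_real (1 / hnorm H x)"
  have c: "cmod ?c = 1 / hnorm H x" using x(2) by (simp add: norm_divide)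
  have "hnorm H (?c \<odot>\<^bsub>H\<^esub> x) = 1" unfolding norm[OF x(1)] c using x(2) by simp
  then have "ereal (hnorm H (A (?c \<odot>\<^bsub>H\<^esub> x))) \<le> op_norm H A"
    unfolding op_norm_def using smult[OF x(1)] by (intro SUP_upper) auto
  then have "hnorm H (A (?c \<odot>\<^bsub>H\<^esub> x)) \<le> r" using r order_trans by fastforce
  then have "1 / hnorm H x * hnorm H (A x) \<le> r"
    unfolding A(1)[OF x(1)] norm[OF A(2)[OF x(1)]] c .
  then show ?thesis using x(2) by (simp add: field_simps)
qed

context hilbert_space
begin

lemma smult_mem [simp]: "x \<in> carrier H \<Longrightarrow> c \<odot> x \<in> carrier H"
  by (rule smult_closed) simp_all

lemma ip_smult_right:
  assumes "x \<in> carrier H" "y \<in> carrier H"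
  shows "ip H x (c \<odot> y) = cnj c * ip H x y"
  using ip_cnj[of "c \<odot> y" x] ip_cnj[of y x] ip_smult[of y x c] assms by simp

lemma ip_zero_left [simp]: "x \<in> carrier H \<Longrightarrow> ip H \<zero> x = 0"
  using ip_add[of \<zero> \<zero> x] by simp

lemma ip_self_nonneg: "x \<in> carrier H \<Longrightarrow> 0 \<le> Re (ip H x x)"
  using ip_pos[of x] by (cases "x = \<zero>") auto

lemma hnorm_sq: "x \<in> carrier H \<Longrightarrow> (hnorm H x)\<^sup>2 = Re (ip H x x)"
  by (simp add: hnorm_def ip_self_nonneg)

lemma ip_self: "x \<in> carrier H \<Longrightarrow> ip H x x = of_real ((hnorm H x)\<^sup>2)"
proof -
  assume x: "x \<in> carrier H"
  then have "Im (ip H x x) = 0" using ip_cnj[OF x x] by (metis Reals_cnj_iff complex_is_Real_iff)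
  then show ?thesis using hnorm_sq[OF x] by (simp add: complex_eq_iff)
qed

lemma hnorm_smult: "x \<in> carrier H \<Longrightarrow> hnorm H (c \<odot> x) = cmod c * hnorm H x"
proof -
  assume x: "x \<in> carrier H"
  have "ip H (c \<odot> x) (c \<odot> x) = of_real ((cmod c)\<^sup>2) * ip H x x"
    using x by (simp only: complex_norm_square ip_smult ip_smult_right smult_mem mult_ac)
  then have "(hnorm H (c \<odot> x))\<^sup>2 = (cmod c * hnorm H x)\<^sup>2"
    using x by (simp add: hnorm_sq power_mult_distrib)
  then show ?thesis
    by (metis abs_of_nonneg hnorm_def ip_self_nonneg mult_nonneg_nonneg norm_ge_zero power2_eq_iff_nonneg
        real_sqrt_ge_zero smult_mem x)
qed

lemma hnorm_nonneg: "x \<in> carrier H \<Longrightarrow> 0 \<le> hnorm H x"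
  by (simp add: hnorm_def ip_self_nonneg)

lemma hnorm_eq_0: "x \<in> carrier H \<Longrightarrow> hnorm H x = 0 \<longleftrightarrow> x = \<zero>"
  using ip_pos[of x] by (cases "x = \<zero>") (auto simp: hnorm_def)

lemma ip_finsum_left:
  assumes "finite A" "e \<in> A \<rightarrow> carrier H" "z \<in> carrier H"
  shows "ip H (\<Oplus>i\<in>A. c i \<odot> e i) z = (\<Sum>i\<in>A. c i * ip H (e i) z)"
  using assms
proof (induction A rule: finite_induct)
  case (insert a F)
  have "(\<Oplus>i\<in>insert a F. c i \<odot> e i) = c a \<odot> e a \<oplus> (\<Oplus>i\<in>F. c i \<odot> e i)"
    using insert by (intro M.finsum_insert) auto
  then show ?case using insert by (auto simp: ip_add ip_smult M.finsum_closed Pi_def)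
qed simp

lemma ip_finsum:
  assumes "finite A" "e \<in> A \<rightarrow> carrier H"
  shows "ip H (\<Oplus>i\<in>A. c i \<odot> e i) (\<Oplus>i\<in>A. d i \<odot> e i) = sform A (\<lambda>i j. ip H (e i) (e j)) c d"
proof -
  have fc: "(\<Oplus>i\<in>A. d i \<odot> e i) \<in> carrier H" using assms by (intro M.finsum_closed) auto
  have "ip H (e i) (\<Oplus>j\<in>A. d j \<odot> e j) = (\<Sum>j\<in>A. cnj (d j) * ip H (e i) (e j))" if "i \<in> A" for i
  proof -
    have ei: "e i \<in> carrier H" using assms that by auto
    have "ip H (e i) (\<Oplus>j\<in>A. d j \<odot> e j) = cnj (\<Sum>j\<in>A. d j * ip H (e j) (e i))"
      using ip_cnj[OF fc ei] ip_finsum_left[OF assms ei] by simp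
    also have "\<dots> = (\<Sum>j\<in>A. cnj (d j) * cnj (ip H (e j) (e i)))" by simp
    also have "\<dots> = (\<Sum>j\<in>A. cnj (d j) * ip H (e i) (e j))"
    proof (rule sum.cong[OF refl])
      fix j assume "j \<in> A"
      then have "e j \<in> carrier H" using assms by auto
      then show "cnj (d j) * cnj (ip H (e j) (e i)) = cnj (d j) * ip H (e i) (e j)"
        using ip_cnj[OF _ ei, of "e j"] by simp
    qed
    finally show ?thesis .
  qed
  then show ?thesis
    by (simp add: ip_finsum_left[OF assms fc] sform_def sum_distrib_left mult.assoc)
qed

lemma psd_on_Gram:
  assumes "finite A" "e \<in> A \<rightarrow> carrier H"
  shows "psd_on A (\<lambda>i j. ip H (e i) (e j))"
proof (rule psd_onI)
  fix u
  have "(\<Oplus>i\<in>A. u i \<odot> e i) \<in> carrier H" using assms by (intro M.finsum_closed) auto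
  then show "0 \<le> qform A (\<lambda>i j. ip H (e i) (e j)) u"
    using ip_self_nonneg by (simp flip: ip_finsum[OF assms])
qed (use assms ip_cnj in blast)

lemma bounded_operatorD:
  assumes "bounded_operator H X"
  shows "x \<in> carrier H \<Longrightarrow> X x \<in> carrier H"
    "x \<in> carrier H \<Longrightarrow> y \<in> carrier H \<Longrightarrow> X (x \<oplus> y) = X x \<oplus> X y"
    "x \<in> carrier H \<Longrightarrow> X (c \<odot> x) = c \<odot> X x"
    "X \<zero> = \<zero>"
proof -
  show a: "x \<in> carrier H \<Longrightarrow> X x \<in> carrier H" for x using assms by (auto simp: bounded_operator_def)
  show b: "x \<in> carrier H \<Longrightarrow> y \<in> carrier H \<Longrightarrow> X (x \<oplus> y) = X x \<oplus> X y" for x y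
    using assms by (auto simp: bounded_operator_def)
  show "x \<in> carrier H \<Longrightarrow> X (c \<odot> x) = c \<odot> X x" using assms by (auto simp: bounded_operator_def)
  show "X \<zero> = \<zero>" using b[of \<zero> \<zero>] a[of \<zero>] by simp
qed

lemma bounded_operator_finsum:
  assumes "bounded_operator H X" "finite A" "e \<in> A \<rightarrow> carrier H"
  shows "X (\<Oplus>i\<in>A. c i \<odot> e i) = (\<Oplus>i\<in>A. c i \<odot> X (e i))"
  using assms(2,3)
proof (induction A rule: finite_induct)
  case empty
  then show ?case using bounded_operatorD[OF assms(1)] by simp
next
  case (insert a F)
  have "(\<Oplus>i\<in>insert a F. c i \<odot> e i) = c a \<odot> e a \<oplus> (\<Oplus>i\<in>F. c i \<odot> e i)"
    using insert by (intro M.finsum_insert) auto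
  moreover have "(\<Oplus>i\<in>insert a F. c i \<odot> X (e i)) = c a \<odot> X (e a) \<oplus> (\<Oplus>i\<in>F. c i \<odot> X (e i))"
    using insert bounded_operatorD(1)[OF assms(1)] by (intro M.finsum_insert) (auto simp: Pi_iff)
  moreover have "(\<Oplus>i\<in>F. c i \<odot> e i) \<in> carrier H" using insert by (intro M.finsum_closed) auto
  ultimately show ?case
    using insert bounded_operatorD(2,3)[OF assms(1)] by (simp add: Pi_iff)
qed

lemma contraction:
  assumes "bounded_operator H X" "op_norm H X \<le> 1" "x \<in> carrier H"
  shows "hnorm H (X x) \<le> hnorm H x"
proof (cases "hnorm H x = 0")
  case True
  then show ?thesis using hnorm_eq_0 assms bounded_operatorD(4)[OF assms(1)] by simp
next
  case False
  then have "hnorm H x > 0" using hnorm_nonneg[OF assms(3)] by simp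
  then have "hnorm H (X x) \<le> 1 * hnorm H x"
    using assms bounded_operatorD[OF assms(1)] hnorm_smult
    by (intro op_norm_bound) (auto simp flip: one_ereal_def)
  then show ?thesis by simp
qed

text \<open>The defect form is positive semidefinite because its value at \<open>u\<close> is \<open>\<parallel>z\<parallel>\<^sup>2 - \<parallel>X z\<parallel>\<^sup>2\<close> for the linear
  combination \<open>z\<close> with coefficients \<open>u\<close>.  It replaces the square root of \<open>1 - X\<^sup>* X\<close> of dilation
  theory.\<close>

lemma psd_on_defect:
  assumes "bounded_operator H X" "op_norm H X \<le> 1" "finite A" "e \<in> A \<rightarrow> carrier H"
  shows "psd_on A (\<lambda>i j. ip H (e i) (e j) - ip H (X (e i)) (X (e j)))"
proof (rule psd_onI)
  have Xe: "(\<lambda>i. X (e i)) \<in> A \<rightarrow> carrier H" using assms(4) bounded_operatorD(1)[OF assms(1)] by auto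
  fix u
  let ?z = "\<Oplus>i\<in>A. u i \<odot> e i"
  have z: "?z \<in> carrier H" using assms by (intro M.finsum_closed) auto
  have "sform A (\<lambda>i j. ip H (e i) (e j) - ip H (X (e i)) (X (e j))) u u
     = sform A (\<lambda>i j. ip H (e i) (e j)) u u - sform A (\<lambda>i j. ip H (X (e i)) (X (e j))) u u"
    by (simp add: sform_def algebra_simps sum_subtractf)
  also have "\<dots> = ip H ?z ?z - ip H (X ?z) (X ?z)"
    by (simp add: bounded_operator_finsum[OF assms(1,3,4)] ip_finsum[OF assms(3,4)] ip_finsum[OF assms(3) Xe])
  finally show "0 \<le> qform A (\<lambda>i j. ip H (e i) (e j) - ip H (X (e i)) (X (e j))) u"
    using power_mono[OF contraction[OF assms(1,2) z], of 2] hnorm_nonneg bounded_operatorD(1)[OF assms(1)] z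
    by (simp add: hnorm_sq)
next
  fix i j assume "i \<in> A" "j \<in> A"
  then have m: "e i \<in> carrier H" "e j \<in> carrier H" using assms by auto
  show "ip H (e j) (e i) - ip H (X (e j)) (X (e i)) = cnj (ip H (e i) (e j) - ip H (X (e i)) (X (e j)))"
    using ip_cnj[OF m] ip_cnj[OF bounded_operatorD(1)[OF assms(1) m(1)] bounded_operatorD(1)[OF assms(1) m(2)]]
    by simp
qed

text \<open>Here \<open>g\<close> lists \<open>x, X1 y, X2 y\<close>, so that applying \<open>X1\<close> gives the vectors \<open>e\<close> at \<open>sites 0\<close> and applying
  \<open>X2\<close> gives those at the shifted sites.  On each half the defect of the Gram kernel of \<open>e\<close> against that
  of \<open>g\<close> is a defect form; adding the same diagonal kernel \<open>\<Delta>\<close> to both halves raises the norms at the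
  \<open>y\<close>-sites to \<open>\<parallel>y\<parallel>\<close>.  At the common site \<open>y\<^sub>1\<close> both halves are then \<open>\<parallel>y\<parallel>\<^sup>2 - \<parallel>X1 X2 y\<parallel>\<^sup>2\<close>, so they can be
  glued.\<close>

lemma stationary_window:
  assumes X1: "bounded_operator H X1" "op_norm H X1 \<le> 1"
    and X2: "bounded_operator H X2" "op_norm H X2 \<le> 1"
    and comm: "commuting_ops H X1 X2"
    and xy: "x \<in> carrier H" "y \<in> carrier H"
  defines "g \<equiv> (\<lambda>(c, k). if c then (if k = 0 then X1 y else X2 y) else x)"
    and "e \<equiv> (\<lambda>(c, k). if c then (if k = 0 then X1 (X1 y) else if k = 1 then X1 (X2 y) else X2 (X2 y))
                      else (if k = 0 then X1 x else X2 x))"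
  shows "\<exists>K. psd_on (sites 1) K \<and>
    (\<forall>i\<in>sites 0. \<forall>j\<in>sites 0. K (shift 1 i) (shift 1 j) = K i j) \<and>
    psd_on (sites 1) (\<lambda>i j. K i j - ip H (e i) (e j)) \<and>
    psd_on (sites 0) (\<lambda>i j. K i j - ip H (g i) (g j)) \<and>
    Re (K (False, 0) (False, 0)) = (hnorm H x)\<^sup>2 \<and> Re (K (True, 0) (True, 0)) = (hnorm H y)\<^sup>2"
proof -
  note D1 = bounded_operatorD[OF X1(1)] and D2 = bounded_operatorD[OF X2(1)]
  note [simp] = D1(1) D2(1) xy
  have cm: "X1 (X2 y) = X2 (X1 y)" using comm xy by (simp add: commuting_ops_def)
  have g_in: "g i \<in> carrier H" for i by (simp add: g_def split: prod.split)
  have e_in: "e i \<in> carrier H" for i by (simp add: e_def split: prod.split)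
  have e1: "e i = X1 (g i)" and e2: "e (shift 1 i) = X2 (g i)" if "i \<in> sites 0" for i
    using that cm by (auto simp: sites_0 e_def g_def shift_def)
  define w where "w = (\<lambda>(c :: bool, k :: nat). if c then (if k = 0 then (hnorm H y)\<^sup>2 - (hnorm H (X1 y))\<^sup>2
       else (hnorm H y)\<^sup>2 - (hnorm H (X2 y))\<^sup>2) else 0)"
  have w: "0 \<le> w i" for i
    using contraction[OF X1 xy(2)] contraction[OF X2 xy(2)] hnorm_nonneg
    by (auto simp: w_def intro!: power_mono split: prod.split)
  define \<Delta> where "\<Delta> = (\<lambda>i j. if i = j then complex_of_real (w i) else 0)"
  have psd\<Delta>: "psd_on (sites 0) \<Delta>" unfolding \<Delta>_def by (rule psd_on_diagonal) (use w in auto)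
  define K1 where "K1 i j = (ip H (g i) (g j) - ip H (X1 (g i)) (X1 (g j))) + \<Delta> i j" for i j
  define K2 where "K2 i j = (ip H (g i) (g j) - ip H (X2 (g i)) (X2 (g j))) + \<Delta> i j" for i j
  \<comment> \<open>the inverse of \<open>shift 1\<close> on its image\<close>
  define h :: "site \<Rightarrow> site" where "h i = (fst i, snd i - 1)" for i
  have h: "h (shift 1 i) = i" for i by (simp add: h_def shift_def)
  have psd1: "psd_on (sites 0) K1"
    unfolding K1_def by (intro psd_on_add psd\<Delta> psd_on_defect X1) (use g_in in auto)
  have psd2: "psd_on (sites 0) K2"
    unfolding K2_def by (intro psd_on_add psd\<Delta> psd_on_defect X2) (use g_in in auto)
  define A :: "site set" where "A = {(False, 0), (True, 0)}"
  define S :: "site set" where "S = {(True, 1)}"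
  define B :: "site set" where "B = {(False, 1), (True, 2)}"
  have AS: "A \<union> S = sites 0" by (auto simp: A_def S_def sites_0)
  have BS: "B \<union> S = shift 1 ` sites 0" by (auto simp: B_def S_def sites_0 shift_def)
  have ASB: "A \<union> S \<union> B = sites 1" by (auto simp: A_def B_def S_def sites_1[simplified])
  have "\<exists>K. psd_on (A \<union> S \<union> B) K \<and> (\<forall>i\<in>A\<union>S. \<forall>j\<in>A\<union>S. K i j = K1 i j) \<and>
     (\<forall>i\<in>B\<union>S. \<forall>j\<in>B\<union>S. K i j = K2 (h i) (h j))"
  proof (rule psd_on_glue)
    show "psd_on (A \<union> S) K1" using psd1 by (simp add: AS)
    show "psd_on (B \<union> S) (\<lambda>i j. K2 (h i) (h j))"
      unfolding BS by (rule psd_on_reindex[OF psd2]) (rule h)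
    show "K1 s t = K2 (h s) (h t)" if "s \<in> S" "t \<in> S" for s t
      using that by (simp add: S_def K1_def K2_def h_def \<Delta>_def g_def w_def ip_self cm)
  qed (auto simp: A_def S_def B_def)
  then obtain K where K: "psd_on (sites 1) K"
    and KA: "\<And>i j. i \<in> sites 0 \<Longrightarrow> j \<in> sites 0 \<Longrightarrow> K i j = K1 i j"
    and KB: "\<And>i j. i \<in> sites 0 \<Longrightarrow> j \<in> sites 0 \<Longrightarrow> K (shift 1 i) (shift 1 j) = K2 i j"
    unfolding ASB unfolding AS BS by (metis h imageI)
  define K0 where "K0 i j = K i j + ip H (e i) (e j)" for i j
  have K0: "K0 i j = ip H (g i) (g j) + \<Delta> i j" "K0 (shift 1 i) (shift 1 j) = ip H (g i) (g j) + \<Delta> i j"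
    if "i \<in> sites 0" "j \<in> sites 0" for i j
    using KA[OF that] KB[OF that] that by (simp_all add: K0_def e1 e2[simplified] K1_def K2_def)
  have "psd_on (sites 1) K0"
    unfolding K0_def by (intro psd_on_add K psd_on_Gram) (use e_in in auto)
  moreover have "psd_on (sites 1) (\<lambda>i j. K0 i j - ip H (e i) (e j))"
    by (rule psd_on_cong[OF K]) (simp add: K0_def)
  moreover have "psd_on (sites 0) (\<lambda>i j. K0 i j - ip H (g i) (g j))"
    by (rule psd_on_cong[OF psd\<Delta>]) (simp add: K0)
  moreover have "Re (K0 (False, 0) (False, 0)) = (hnorm H x)\<^sup>2" "Re (K0 (True, 0) (True, 0)) = (hnorm H y)\<^sup>2"
    by (simp_all add: K0 sites_0 \<Delta>_def g_def w_def hnorm_sq)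
  ultimately show ?thesis using K0 by (intro exI[of _ K0]) simp
qed

text \<open>The kernel of the window dominates the Gram kernels of \<open>e\<close> and of \<open>g\<close>, which bound the two
  components of the image of \<open>(x, y)\<close>.\<close>

lemma toeplitz_commuting_contractions:
  assumes X1: "bounded_operator H X1" "op_norm H X1 \<le> 1"
    and X2: "bounded_operator H X2" "op_norm H X2 \<le> 1"
    and comm: "commuting_ops H X1 X2"
    and xy: "x \<in> carrier H" "y \<in> carrier H"
    and D: "\<And>t \<xi> \<eta>. cmod t = 1 \<Longrightarrow>
      (cmod ((a + b * t) * \<xi> + (c0 + c1 * t + c2 * t\<^sup>2) * \<eta>))\<^sup>2 + (cmod ((a + b * t) * \<eta>))\<^sup>2
        \<le> D * ((cmod \<xi>)\<^sup>2 + (cmod \<eta>)\<^sup>2)"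
  shows "(hnorm H ((a \<odot> X1 x \<oplus> b \<odot> X2 x) \<oplus> (c0 \<odot> X1 (X1 y) \<oplus> c1 \<odot> X1 (X2 y) \<oplus> c2 \<odot> X2 (X2 y))))\<^sup>2
      + (hnorm H (a \<odot> X1 y \<oplus> b \<odot> X2 y))\<^sup>2 \<le> D * ((hnorm H x)\<^sup>2 + (hnorm H y)\<^sup>2)"
proof -
  note D1 = bounded_operatorD[OF X1(1)] and D2 = bounded_operatorD[OF X2(1)]
  note [simp] = D1(1) D2(1) xy
  define g where "g = (\<lambda>(c, k). if c then (if k = (0::nat) then X1 y else X2 y) else x)"
  define e where "e = (\<lambda>(c, k). if c then (if k = (0::nat) then X1 (X1 y) else if k = 1 then X1 (X2 y) else X2 (X2 y))
                      else (if k = 0 then X1 x else X2 x))"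
  have g_in: "g \<in> S \<rightarrow> carrier H" for S by (auto simp add: g_def split: prod.split)
  have e_in: "e \<in> S \<rightarrow> carrier H" for S by (auto simp add: e_def split: prod.split)
  define upper where "upper = (\<lambda>(c, k). if c then (if k = (0::nat) then c0 else if k = 1 then c1 else c2) else (if k = 0 then a else b))"
  define lower where "lower = (\<lambda>(c, k). if c then (if k = (0::nat) then a else if k = 1 then b else 0) else 0)"
  obtain K where K: "psd_on (sites 1) K"
    "\<forall>i\<in>sites 0. \<forall>j\<in>sites 0. K (shift 1 i) (shift 1 j) = K i j"
    and Ke: "psd_on (sites 1) (\<lambda>i j. K i j - ip H (e i) (e j))"
    and Kg: "psd_on (sites 0) (\<lambda>i j. K i j - ip H (g i) (g j))"
    and Kd: "Re (K (False, 0) (False, 0)) = (hnorm H x)\<^sup>2" "Re (K (True, 0) (True, 0)) = (hnorm H y)\<^sup>2"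
    using stationary_window[OF X1 X2 comm xy] unfolding g_def e_def by blast
  have dominate: "(hnorm H (\<Oplus>i\<in>S. u i \<odot> f i))\<^sup>2 \<le> qform S K u"
    if "psd_on S (\<lambda>i j. K i j - ip H (f i) (f j))" "f \<in> S \<rightarrow> carrier H" "finite S" for S f u
  proof -
    have "(\<Oplus>i\<in>S. u i \<odot> f i) \<in> carrier H" using that(2) by (intro M.finsum_closed) auto
    then have "(hnorm H (\<Oplus>i\<in>S. u i \<odot> f i))\<^sup>2 = qform S (\<lambda>i j. ip H (f i) (f j)) u"
      by (simp add: hnorm_sq ip_finsum[OF that(3,2)])
    moreover have "sform S (\<lambda>i j. K i j - ip H (f i) (f j)) u u = sform S K u u - sform S (\<lambda>i j. ip H (f i) (f j)) u u"
      by (simp add: sform_def algebra_simps sum_subtractf)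
    ultimately show ?thesis using psd_on_nonneg[OF that(1), of u] by simp
  qed
  have upper_sum: "(\<Oplus>i\<in>sites 1. upper i \<odot> e i) =
      (a \<odot> X1 x \<oplus> b \<odot> X2 x) \<oplus> (c0 \<odot> X1 (X1 y) \<oplus> c1 \<odot> X1 (X2 y) \<oplus> c2 \<odot> X2 (X2 y))"
    unfolding sites_1 by (simp add: upper_def e_def M.a_ac M.finsum_insert M.finsum_empty)
  have lower_sum: "(\<Oplus>i\<in>sites 0. lower i \<odot> g i) = a \<odot> X1 y \<oplus> b \<odot> X2 y"
    unfolding sites_0 using smult_l_null[of x] by (simp add: lower_def g_def M.a_ac)
  have "sform (sites 1) K lower lower = sform (sites 0) K lower lower"
    by (rule sform_support[OF finite_sites]) (auto simp: sites_0 sites_1[simplified] lower_def)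
  then have "(hnorm H (a \<odot> X1 y \<oplus> b \<odot> X2 y))\<^sup>2 \<le> qform (sites 1) K lower"
    using dominate[OF Kg g_in finite_sites, of lower] by (simp add: lower_sum)
  moreover have "(hnorm H ((a \<odot> X1 x \<oplus> b \<odot> X2 x) \<oplus> (c0 \<odot> X1 (X1 y) \<oplus> c1 \<odot> X1 (X2 y) \<oplus> c2 \<odot> X2 (X2 y))))\<^sup>2
     \<le> qform (sites 1) K upper"
    using dominate[OF Ke e_in finite_sites, of upper] by (simp only: upper_sum)
  moreover have "qform (sites 1) K upper + qform (sites 1) K lower \<le> D * ((hnorm H x)\<^sup>2 + (hnorm H y)\<^sup>2)"
    unfolding upper_def lower_def Kd[symmetric]
    by (rule stationary_toeplitz_bound[OF K(1) _ D]) (use K(2) in auto)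
  ultimately show ?thesis by linarith
qed

end

section \<open>Symmetry of the mixed partial derivatives\<close>

lemma holomorphic_second_order_bound:
  assumes hol: "g holomorphic_on ball 0 1" and bd: "\<And>z. z \<in> ball 0 1 \<Longrightarrow> cmod (g z) \<le> 1"
    and w: "cmod w \<le> 1/2"
  shows "cmod (g w - g 0 - w * deriv g 0) \<le> 32 * (cmod w)\<^sup>2"
proof -
  let ?S = "cball 0 (1/2) :: complex set"
  have sub: "cball x (1/4) \<subseteq> ball 0 1" if "x \<in> ?S" for x
  proof
    fix y assume "y \<in> cball x (1/4)"
    then show "y \<in> ball 0 1" using that norm_triangle_ineq2[of y x] by (auto simp: dist_norm norm_minus_commute)
  qed
  have "cmod ((deriv ^^ 0) g w - (\<Sum>i\<le>1. (deriv ^^ i) g 0 * (w - 0) ^ i / fact i)) \<le> 32 * cmod (w - 0) ^ Suc 1 / fact 1"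
  proof (rule complex_Taylor[of ?S 1 "\<lambda>i. (deriv ^^ i) g" 32 0 w])
    fix i x assume x: "x \<in> ?S"
    then have "x \<in> ball 0 1" by auto
    then have "((deriv ^^ i) g has_field_derivative (deriv ^^ Suc i) g x) (at x)"
      using holomorphic_derivI[OF holomorphic_higher_deriv[OF hol open_ball, of i] open_ball] by simp
    then show "((deriv ^^ i) g has_field_derivative (deriv ^^ Suc i) g x) (at x within ?S)"
      by (rule has_field_derivative_at_within)
  next
    fix x assume x: "x \<in> ?S"
    \<comment> \<open>discs of radius 1/4 around points of the disc of radius 1/2 stay inside the unit disc\<close>
    have "cmod ((deriv ^^ 2) g x) \<le> fact 2 * 1 / (1/4) ^ 2"
    proof (rule Cauchy_inequality)
      show "g holomorphic_on ball x (1/4)"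
        using holomorphic_on_subset[OF hol] sub[OF x] by (meson ball_subset_cball subset_trans)
      show "continuous_on (cball x (1/4)) g"
        using holomorphic_on_imp_continuous_on[OF hol] sub[OF x] continuous_on_subset by blast
      show "cmod (g y) \<le> 1" if "cmod (x - y) = 1/4" for y
      proof (rule bd)
        have "y \<in> cball x (1/4)" using that by (simp add: dist_norm)
        then show "y \<in> ball 0 1" using sub[OF x] by blast
      qed
    qed simp
    then show "cmod ((deriv ^^ Suc 1) g x) \<le> 32" unfolding Suc_1 by (simp add: power2_eq_square)
  qed (use w in auto)
  then show ?thesis by (simp add: power2_eq_square algebra_simps)
qed

text \<open>The first-order remainder in \<open>w\<close> is quadratically small uniformly in \<open>v\<close>.  Hence the difference
  quotients in \<open>w\<close> converge uniformly, their limit \<open>G\<close> is holomorphic in \<open>v\<close>, and the Cauchy estimate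
  makes the \<open>v\<close>-derivative of the remainder quadratically small as well.\<close>

lemma mixed_deriv_symmetric:
  fixes F :: "complex \<Rightarrow> complex \<Rightarrow> complex"
  assumes h1: "\<And>v. v \<in> ball 0 1 \<Longrightarrow> (\<lambda>w. F w v) holomorphic_on ball 0 1"
    and h2: "\<And>w. w \<in> ball 0 1 \<Longrightarrow> F w holomorphic_on ball 0 1"
    and bd: "\<And>w v. w \<in> ball 0 1 \<Longrightarrow> v \<in> ball 0 1 \<Longrightarrow> cmod (F w v) \<le> 1"
  shows "deriv (\<lambda>w. deriv (F w) 0) 0 = deriv (\<lambda>v. deriv (\<lambda>w. F w v) 0) 0"
proof -
  define G where "G v = deriv (\<lambda>w. F w v) 0" for v
  have taylor: "cmod (F w v - F 0 v - w * G v) \<le> 32 * (cmod w)\<^sup>2" if "cmod w \<le> 1/2" "v \<in> ball 0 1" for w v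
    unfolding G_def by (rule holomorphic_second_order_bound[OF h1[OF that(2)] _ that(1)]) (use bd that in auto)
  have holG: "G holomorphic_on ball 0 1"
  proof (rule holomorphic_uniform_sequence)
    define t :: "nat \<Rightarrow> complex" where "t n = 1 / of_nat (n + 2)" for n
    have t: "cmod (t n) \<le> 1/2" "t n \<noteq> 0" "t n \<in> ball 0 1" "cmod (t n) = 1 / real (n + 2)" for n
    proof -
      show e: "cmod (t n) = 1 / real (n + 2)" unfolding t_def norm_divide norm_of_nat by simp
      show "t n \<noteq> 0" unfolding t_def divide_eq_0_iff of_nat_eq_0_iff by simp
      show "cmod (t n) \<le> 1/2" unfolding e by simp
      then show "t n \<in> ball 0 1" by simp
    qed
    show "(\<lambda>v. (F (t n) v - F 0 v) / t n) holomorphic_on ball 0 1" for n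
      by (intro holomorphic_intros h2 t) simp
    have err: "cmod ((F (t n) v - F 0 v) / t n - G v) \<le> 32 / real (n + 2)" if "v \<in> ball 0 1" for n v
    proof -
      have "(F (t n) v - F 0 v) / t n - G v = (F (t n) v - F 0 v - t n * G v) / t n"
        using t(2)[of n] by (simp add: field_simps)
      then have "cmod ((F (t n) v - F 0 v) / t n - G v) \<le> 32 * (cmod (t n))\<^sup>2 / cmod (t n)"
        using taylor[OF t(1) that, of n] by (simp add: norm_divide divide_right_mono)
      also have "\<dots> = 32 * cmod (t n)" using t(2)[of n] by (simp add: power2_eq_square)
      finally show ?thesis unfolding t(4) by simp
    qed
    have "(\<lambda>n. 32 / real (n + 2)) \<longlonglongrightarrow> 0" by real_asymp
    then have "uniform_limit (ball 0 1) (\<lambda>n v. (F (t n) v - F 0 v) / t n) G sequentially"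
      unfolding uniform_limit_iff
    proof (intro allI impI)
      fix e :: real assume "e > 0"
      have "eventually (\<lambda>n. 32 / real (n + 2) < e) sequentially"
        using \<open>(\<lambda>n. 32 / real (n + 2)) \<longlonglongrightarrow> 0\<close> \<open>e > 0\<close> by (rule order_tendstoD)
      then show "\<forall>\<^sub>F n in sequentially. \<forall>v\<in>ball 0 1. dist ((F (t n) v - F 0 v) / t n) (G v) < e"
      proof eventually_elim
        case (elim n)
        show ?case unfolding dist_norm
        proof
          fix v :: complex assume "v \<in> ball 0 1"
          from err[OF this, of n] elim show "cmod ((F (t n) v - F 0 v) / t n - G v) < e" by (rule le_less_trans)
        qed
      qed
    qed
    then show "\<exists>d>0. cball v d \<subseteq> ball 0 1 \<and> uniform_limit (cball v d) (\<lambda>n v. (F (t n) v - F 0 v) / t n) G sequentially"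
      if "v \<in> ball 0 1" for v
      using open_contains_cball[of "ball 0 1 :: complex set"] that uniform_limit_on_subset by blast
  qed simp
  have diff: "g field_differentiable at 0" if "g holomorphic_on ball 0 1" for g :: "complex \<Rightarrow> complex"
    using that by (simp add: holomorphic_on_imp_differentiable_at)
  have quot: "cmod ((deriv (F w) 0 - deriv (F 0) 0) / w - deriv G 0) \<le> 64 * cmod w"
    if w: "cmod w \<le> 1/2" "w \<noteq> 0" for w
  proof -
    have wb: "w \<in> ball 0 1" using w by simp
    define R where "R v = F w v - F 0 v - w * G v" for v
    have holR: "R holomorphic_on ball 0 1"
      unfolding R_def by (intro holomorphic_intros h2 holG wb) simp
    have "deriv R 0 = deriv (F w) 0 - deriv (F 0) 0 - w * deriv G 0"
      unfolding R_def
      using diff[OF h2[OF wb]] diff[OF h2[of 0]] diff[OF holG]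
      by (simp add: deriv_diff deriv_cmult field_differentiable_diff field_differentiable_mult)
    moreover have "cmod ((deriv ^^ 1) R 0) \<le> fact 1 * (32 * (cmod w)\<^sup>2) / (1/2) ^ 1"
    proof (rule Cauchy_inequality)
      have sub: "cball 0 (1/2) \<subseteq> ball (0 :: complex) 1" by auto
      show "R holomorphic_on ball 0 (1/2)"
        using holomorphic_on_subset[OF holR] sub by (meson ball_subset_cball subset_trans)
      show "continuous_on (cball 0 (1/2)) R"
        using holomorphic_on_imp_continuous_on[OF holR] sub continuous_on_subset by blast
      show "cmod (R v) \<le> 32 * (cmod w)\<^sup>2" if "cmod (0 - v) = 1/2" for v
        unfolding R_def by (rule taylor) (use w that in auto)
    qed simp
    ultimately have "cmod (deriv (F w) 0 - deriv (F 0) 0 - w * deriv G 0) \<le> 64 * (cmod w)\<^sup>2" by simp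
    moreover have "(deriv (F w) 0 - deriv (F 0) 0) / w - deriv G 0 = (deriv (F w) 0 - deriv (F 0) 0 - w * deriv G 0) / w"
      using w by (simp add: field_simps)
    ultimately show ?thesis using w by (simp add: norm_divide field_simps power2_eq_square)
  qed
  have "((\<lambda>w. (deriv (F w) 0 - deriv (F 0) 0) / w - deriv G 0) \<longlongrightarrow> 0) (at 0)"
  proof (rule Lim_null_comparison)
    show "\<forall>\<^sub>F w in at 0. cmod ((deriv (F w) 0 - deriv (F 0) 0) / w - deriv G 0) \<le> 64 * cmod w"
      unfolding eventually_at by (intro exI[of _ "1/2"]) (use quot in auto)
    show "((\<lambda>w. 64 * cmod w) \<longlongrightarrow> 0) (at 0)" by (intro tendsto_eq_intros) auto
  qed
  then have "((\<lambda>w. deriv (F w) 0) has_field_derivative deriv G 0) (at 0)"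
    unfolding DERIV_def by (simp add: LIM_zero_iff)
  then show ?thesis unfolding G_def using DERIV_imp_deriv by blast
qed

lemma holomorphic2_on_slice:
  assumes "holomorphic2_on f bidisc" "z \<in> bidisc"
  shows "(\<lambda>w. f (\<chi> j. if j = i then w else z $ j)) holomorphic_on ball 0 1"
proof -
  let ?l = "\<lambda>w :: complex. (\<chi> j. if j = i then w else z $ j)"
  let ?L = "\<lambda>h :: complex. (\<chi> j. if j = i then h else 0) :: complex ^ 2"
  have "linear ?L" by (rule linearI) (auto simp: vec_eq_iff)
  then have bl: "bounded_linear ?L" by (simp add: linear_conv_bounded_linear)
  have l: "?l = (\<lambda>w. (\<chi> j. if j = i then 0 else z $ j) + ?L w)" by (auto simp: vec_eq_iff)
  have img: "?l ` ball 0 1 \<subseteq> bidisc" using assms(2) by (auto simp: bidisc_def)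
  show ?thesis unfolding holomorphic_on_def
  proof
    fix w :: complex assume w: "w \<in> ball 0 1"
    then obtain a :: "complex ^ 2" where a: "(f has_derivative (\<lambda>h. \<Sum>j\<in>UNIV. a $ j * h $ j)) (at (?l w) within bidisc)"
      using assms(1) img unfolding holomorphic2_on_def by blast
    have "(?l has_derivative ?L) (at w within ball 0 1)"
      unfolding l using bounded_linear.has_derivative[OF bl has_derivative_ident]
      by (rule has_derivative_add[OF has_derivative_const, simplified])
    moreover have "(f has_derivative (\<lambda>h. \<Sum>j\<in>UNIV. a $ j * h $ j)) (at (?l w) within ?l ` ball 0 1)"
      using a img has_derivative_subset by blast
    ultimately have "((\<lambda>w. f (?l w)) has_derivative (\<lambda>h. \<Sum>j\<in>UNIV. a $ j * ?L h $ j)) (at w within ball 0 1)"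
      by (rule has_derivative_in_compose)
    moreover have "(\<Sum>j\<in>UNIV. a $ j * ?L h $ j) = a $ i * h" for h
    proof -
      have "(\<Sum>j\<in>UNIV. a $ j * ?L h $ j) = (\<Sum>j\<in>UNIV. if j = i then a $ j * h else 0)"
        by (intro sum.cong) auto
      then show ?thesis by simp
    qed
    ultimately show "(\<lambda>w. f (?l w)) field_differentiable at w within ball 0 1"
      unfolding field_differentiable_def has_field_derivative_def by auto
  qed
qed

lemma partial_symmetric:
  assumes hol: "holomorphic2_on f bidisc" and bd: "\<forall>z\<in>bidisc. norm (f z) \<le> 1"
  shows "partial 1 (partial 2 f) 0 = partial 2 (partial 1 f) 0"
proof -
  define F where "F w v = f (\<chi> j. if j = 1 then w else v)" for w v
  have mem: "(\<chi> j. if j = (1 :: 2) then w else v) \<in> bidisc" if "w \<in> ball 0 1" "v \<in> ball 0 1" for w v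
    using that by (auto simp: bidisc_def)
  have n12: "(1 :: 2) \<noteq> 2" by simp
  have F2: "F w v = f (\<chi> j. if j = 2 then v else (\<chi> j. if j = (1 :: 2) then w else (0 :: complex ^ 2) $ j) $ j)" for w v
    unfolding F_def by (rule arg_cong[of _ _ f]) (use exhaust_2 n12 in \<open>auto simp: vec_eq_iff\<close>)
  have F1: "F w v = f (\<chi> j. if j = 1 then w else (\<chi> j. if j = (2 :: 2) then v else (0 :: complex ^ 2) $ j) $ j)" for w v
    unfolding F_def by (rule arg_cong[of _ _ f]) (use exhaust_2 n12 in \<open>auto simp: vec_eq_iff\<close>)
  have p2: "partial 2 f (\<chi> j. if j = 1 then w else (0 :: complex ^ 2) $ j) = deriv (F w) 0" for w
  proof -
    have "F w = (\<lambda>v. f (\<chi> j. if j = 2 then v else (\<chi> j. if j = (1 :: 2) then w else (0 :: complex ^ 2) $ j) $ j))"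
      by (rule ext, rule F2)
    then show ?thesis by (simp add: partial_def)
  qed
  have p1: "partial 1 f (\<chi> j. if j = 2 then v else (0 :: complex ^ 2) $ j) = deriv (\<lambda>w. F w v) 0" for v
  proof -
    have "(\<lambda>w. F w v) = (\<lambda>w. f (\<chi> j. if j = 1 then w else (\<chi> j. if j = (2 :: 2) then v else (0 :: complex ^ 2) $ j) $ j))"
      by (rule ext, rule F1)
    then show ?thesis by (simp add: partial_def)
  qed
  have "deriv (\<lambda>w. deriv (F w) 0) 0 = deriv (\<lambda>v. deriv (\<lambda>w. F w v) 0) 0"
  proof (rule mixed_deriv_symmetric)
    show "(\<lambda>w. F w v) holomorphic_on ball 0 1" if "v \<in> ball 0 1" for v
      unfolding F1 by (rule holomorphic2_on_slice[OF hol]) (use that in \<open>auto simp: bidisc_def\<close>)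
    show "F w holomorphic_on ball 0 1" if "w \<in> ball 0 1" for w
      unfolding F2 by (rule holomorphic2_on_slice[OF hol]) (use that in \<open>auto simp: bidisc_def\<close>)
    show "cmod (F w v) \<le> 1" if "w \<in> ball 0 1" "v \<in> ball 0 1" for w v
      using bd mem[OF that] by (simp add: F_def)
  qed
  then show ?thesis by (simp add: partial_def[of 1 "partial 2 f"] partial_def[of 2 "partial 1 f"] p1 p2)
qed

section \<open>Multiplication operators on the circle\<close>

lemma square_integrable_add:
  assumes "square_integrable M f" "square_integrable M g"
  shows "square_integrable M (\<lambda>x. f x + g x)"
proof -
  have m: "f \<in> borel_measurable M" "g \<in> borel_measurable M"
    and i: "integrable M (\<lambda>x. (cmod (f x))\<^sup>2)" "integrable M (\<lambda>x. (cmod (g x))\<^sup>2)"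
    using assms by (auto simp: square_integrable_def)
  have "integrable M (\<lambda>x. (cmod (f x + g x))\<^sup>2)"
  proof (rule Bochner_Integration.integrable_bound)
    show "integrable M (\<lambda>x. 2 * (cmod (f x))\<^sup>2 + 2 * (cmod (g x))\<^sup>2)" using i by simp
    show "AE x in M. norm ((cmod (f x + g x))\<^sup>2) \<le> norm (2 * (cmod (f x))\<^sup>2 + 2 * (cmod (g x))\<^sup>2)"
    proof (rule AE_I2)
      fix x
      have "(cmod (f x + g x))\<^sup>2 \<le> (cmod (f x) + cmod (g x))\<^sup>2"
        by (intro power_mono norm_triangle_ineq) simp
      also have "\<dots> \<le> 2 * (cmod (f x))\<^sup>2 + 2 * (cmod (g x))\<^sup>2"
        using sum_squares_bound[of "cmod (f x)" "cmod (g x)"] by (simp add: power2_sum)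
      finally show "norm ((cmod (f x + g x))\<^sup>2) \<le> norm (2 * (cmod (f x))\<^sup>2 + 2 * (cmod (g x))\<^sup>2)"
        by simp
    qed
  qed (use m in measurable)
  then show ?thesis using m by (simp add: square_integrable_def)
qed

lemma square_integrable_mult:
  assumes "square_integrable M f" "h \<in> borel_measurable M" "\<And>x. x \<in> space M \<Longrightarrow> cmod (h x) \<le> B"
  shows "square_integrable M (\<lambda>x. h x * f x)"
proof -
  have m: "f \<in> borel_measurable M" and i: "integrable M (\<lambda>x. (cmod (f x))\<^sup>2)"
    using assms by (auto simp: square_integrable_def)
  have "integrable M (\<lambda>x. (cmod (h x * f x))\<^sup>2)"
  proof (rule Bochner_Integration.integrable_bound)
    show "integrable M (\<lambda>x. B\<^sup>2 * (cmod (f x))\<^sup>2)" using i by simp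
    show "AE x in M. norm ((cmod (h x * f x))\<^sup>2) \<le> norm (B\<^sup>2 * (cmod (f x))\<^sup>2)"
      using assms(3) by (intro AE_I2) (auto simp: norm_mult power_mult_distrib intro!: mult_right_mono power_mono)
  qed (use m assms(2) in measurable)
  then show ?thesis using m assms(2) by (simp add: square_integrable_def)
qed

lemma L2_class_iff: "g \<in> L2_class M f \<longleftrightarrow> square_integrable M f \<and> square_integrable M g \<and> (AE x in M. f x = g x)"
  by (auto simp: L2_class_def L2_rel_def)

lemma L2_class_self: "square_integrable M f \<Longrightarrow> f \<in> L2_class M f"
  by (simp add: L2_class_iff)

lemma L2_class_eqI:
  assumes "square_integrable M f" "square_integrable M g" "AE x in M. f x = g x"
  shows "L2_class M f = L2_class M g"
proof (rule Set.set_eqI)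
  fix h
  have "(AE x in M. f x = h x) \<longleftrightarrow> (AE x in M. g x = h x)"
  proof
    assume "AE x in M. f x = h x"
    with assms(3) show "AE x in M. g x = h x" by eventually_elim simp
  next
    assume "AE x in M. g x = h x"
    with assms(3) show "AE x in M. f x = h x" by eventually_elim simp
  qed
  then show "h \<in> L2_class M f \<longleftrightarrow> h \<in> L2_class M g"
    using assms by (simp add: L2_class_iff)
qed

lemma carrier_L2: "F \<in> carrier (L2 M) \<longleftrightarrow> (\<exists>f. square_integrable M f \<and> F = L2_class M f)"
  by (auto simp: L2_def quotient_def L2_class_def)

text \<open>The operations of \<open>L2\<close> are unions over representatives in which all members coincide.\<close>

lemma UN_UN_eq_const:
  assumes "a \<in> A" "b \<in> B" "\<And>x y. x \<in> A \<Longrightarrow> y \<in> B \<Longrightarrow> C x y = c"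
  shows "(\<Union>x\<in>A. \<Union>y\<in>B. C x y) = c"
proof -
  have "(\<Union>x\<in>A. \<Union>y\<in>B. C x y) = (\<Union>x\<in>A. \<Union>y\<in>B. c)"
    by (intro SUP_cong refl assms(3))
  also have "\<dots> = c" using assms(1,2) by blast
  finally show ?thesis .
qed

lemma L2_add:
  assumes "square_integrable M f" "square_integrable M g"
  shows "L2_class M f \<oplus>\<^bsub>L2 M\<^esub> L2_class M g = L2_class M (\<lambda>x. f x + g x)"
proof -
  have "L2_class M (\<lambda>x. f' x + g' x) = L2_class M (\<lambda>x. f x + g x)"
    if "f' \<in> L2_class M f" "g' \<in> L2_class M g" for f' g'
    using that assms by (intro L2_class_eqI square_integrable_add) (auto simp: L2_class_iff)
  then have "(\<Union>f'\<in>L2_class M f. \<Union>g'\<in>L2_class M g. L2_class M (\<lambda>x. f' x + g' x)) = L2_class M (\<lambda>x. f x + g x)"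
    by (intro UN_UN_eq_const[OF L2_class_self[OF assms(1)] L2_class_self[OF assms(2)]])
  then show ?thesis by (simp add: L2_def)
qed

lemma L2_ip:
  assumes "square_integrable M f" "square_integrable M g"
  shows "ip (L2 M) (L2_class M f) (L2_class M g) = (\<integral>x. f x * cnj (g x) \<partial>M)"
proof -
  have "(\<integral>x. f' x * cnj (g' x) \<partial>M) = (\<integral>x. f x * cnj (g x) \<partial>M)"
    if "f' \<in> L2_class M f" "g' \<in> L2_class M g" for f' g'
  proof (rule integral_cong_AE)
    have "f' \<in> borel_measurable M" "g' \<in> borel_measurable M" "f \<in> borel_measurable M" "g \<in> borel_measurable M"
      using that by (auto simp: L2_class_iff square_integrable_def)
    then show "(\<lambda>x. f' x * cnj (g' x)) \<in> borel_measurable M" "(\<lambda>x. f x * cnj (g x)) \<in> borel_measurable M"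
      using measurable_compose[OF _ borel_measurable_continuous_onI[of cnj]]
      by (auto intro!: borel_measurable_times continuous_intros)
    show "AE x in M. f' x * cnj (g' x) = f x * cnj (g x)"
      using that by (auto simp: L2_class_iff)
  qed
  then have "(\<Union>f'\<in>L2_class M f. \<Union>g'\<in>L2_class M g. {\<integral>x. f' x * cnj (g' x) \<partial>M}) = {\<integral>x. f x * cnj (g x) \<partial>M}"
    by (intro UN_UN_eq_const[OF L2_class_self[OF assms(1)] L2_class_self[OF assms(2)]]) simp
  then show ?thesis by (simp add: L2_def)
qed

lemma L2_ip_self:
  assumes "square_integrable M f"
  shows "Re (ip (L2 M) (L2_class M f) (L2_class M f)) = (\<integral>x. (cmod (f x))\<^sup>2 \<partial>M)"
proof -
  have "(\<lambda>x. f x * cnj (f x)) = (\<lambda>x. complex_of_real ((cmod (f x))\<^sup>2))"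
    by (simp only: complex_norm_square)
  then show ?thesis
    unfolding L2_ip[OF assms assms] by (metis Re_complex_of_real integral_complex_of_real)
qed

lemma hnorm_hsum_L2:
  assumes "square_integrable M f" "square_integrable M g"
  shows "hnorm (hsum (L2 M) (L2 M)) (L2_class M f, L2_class M g)
       = sqrt ((\<integral>x. (cmod (f x))\<^sup>2 \<partial>M) + (\<integral>x. (cmod (g x))\<^sup>2 \<partial>M))"
  using assms by (simp add: hnorm_def hsum_def L2_ip_self)

lemma cis_measurable: "cis \<in> measurable (uniform_measure lborel {0..2 * pi}) (restrict_space borel (sphere 0 1))"
proof (rule measurable_restrict_space2)
  have "cis \<in> borel_measurable borel" by (intro borel_measurable_continuous_onI continuous_intros)
  then show "cis \<in> borel_measurable (uniform_measure lborel {0..2 * pi})"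
    by (simp add: measurable_cong_sets[OF sets_uniform_measure refl])
qed auto

lemma space_circle [simp]: "space circle_measure = sphere 0 1"
  by (simp add: circle_measure_def space_restrict_space)

lemma borel_measurable_circle: "f \<in> borel_measurable borel \<Longrightarrow> f \<in> borel_measurable circle_measure"
  unfolding circle_measure_def measurable_distr_eq1 by (rule measurable_restrict_space1)

lemma emeasure_circle:
  assumes "E \<in> sets circle_measure"
  shows "emeasure circle_measure E = emeasure lborel ({0..2 * pi} \<inter> cis -` E) / ennreal (2 * pi)"
proof -
  have E: "E \<in> sets (restrict_space borel (sphere 0 1))" using assms by (simp add: circle_measure_def)
  have "cis -` E \<in> sets borel"
    using measurable_sets[OF cis_measurable E] by simp
  moreover have "emeasure circle_measure E = emeasure (uniform_measure lborel {0..2 * pi}) (cis -` E)"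
    unfolding circle_measure_def by (subst emeasure_distr[OF cis_measurable E]) simp
  ultimately show ?thesis by simp
qed

lemma finite_measure_circle: "finite_measure circle_measure"
proof
  have "sphere 0 1 \<in> sets circle_measure" using sets.top[of circle_measure] by simp
  then have "emeasure circle_measure (sphere 0 1) \<le> emeasure lborel {0..2 * pi} / ennreal (2 * pi)"
    by (simp only: emeasure_circle) (intro divide_right_mono_ennreal emeasure_mono; simp)
  also have "\<dots> < \<infinity>" by (simp add: divide_ennreal)
  finally show "emeasure circle_measure (space circle_measure) \<noteq> \<infinity>" by simp
qed

lemma square_integrable_poly:
  assumes "square_integrable circle_measure f"
  shows "square_integrable circle_measure (\<lambda>z. poly p z * f z)"
proof -
  have "bounded (poly p ` sphere 0 1)"
    by (intro compact_imp_bounded compact_continuous_image continuous_intros) simp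
  then obtain B where "\<forall>z\<in>sphere 0 1. cmod (poly p z) \<le> B" unfolding bounded_iff by auto
  then show ?thesis
    by (intro square_integrable_mult[OF assms, of _ B] borel_measurable_circle borel_measurable_continuous_onI)
       (auto intro!: continuous_intros)
qed

lemma mult_op_class:
  assumes "square_integrable circle_measure f"
  shows "mult_op p (L2_class circle_measure f) = L2_class circle_measure (\<lambda>z. poly p z * f z)"
proof -
  have "L2_class circle_measure (\<lambda>z. poly p z * f' z) = L2_class circle_measure (\<lambda>z. poly p z * f z)"
    if "f' \<in> L2_class circle_measure f" for f'
    using that assms by (intro L2_class_eqI square_integrable_poly) (auto simp: L2_class_iff)
  then have "mult_op p (L2_class circle_measure f)
      = (\<Union>f'\<in>L2_class circle_measure f. L2_class circle_measure (\<lambda>z. poly p z * f z))"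
    unfolding mult_op_def by (intro SUP_cong refl)
  also have "\<dots> = L2_class circle_measure (\<lambda>z. poly p z * f z)" using L2_class_self[OF assms] by blast
  finally show ?thesis .
qed

lemma hnorm_toeplitz_mult_op:
  assumes f: "square_integrable circle_measure f" and g: "square_integrable circle_measure g"
  shows "hnorm (hsum (L2 circle_measure) (L2 circle_measure))
      (toeplitz (L2 circle_measure) (mult_op p) (mult_op q) (L2_class circle_measure f, L2_class circle_measure g))
   = sqrt (\<integral>z. (cmod (poly p z * f z + poly q z * g z))\<^sup>2 + (cmod (poly p z * g z))\<^sup>2 \<partial>circle_measure)"
proof -
  note sq = square_integrable_poly[OF f] square_integrable_poly[OF g]
  have "integrable circle_measure (\<lambda>z. (cmod (poly p z * f z + poly q z * g z))\<^sup>2)"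
       "integrable circle_measure (\<lambda>z. (cmod (poly p z * g z))\<^sup>2)"
    using square_integrable_add[OF sq(1)[of p] sq(2)[of q]] sq(2)[of p] by (simp_all add: square_integrable_def)
  then show ?thesis
    by (simp add: toeplitz_def mult_op_class f g L2_add sq hnorm_hsum_L2 square_integrable_add)
qed

lemma op_norm_toeplitz_mult_op_le:
  assumes s: "0 \<le> s"
    and bd: "\<And>t \<xi> \<eta>. cmod t = 1 \<Longrightarrow> (cmod (poly p t * \<xi> + poly q t * \<eta>))\<^sup>2 + (cmod (poly p t * \<eta>))\<^sup>2
        \<le> s\<^sup>2 * ((cmod \<xi>)\<^sup>2 + (cmod \<eta>)\<^sup>2)"
  shows "op_norm (hsum (L2 circle_measure) (L2 circle_measure)) (toeplitz (L2 circle_measure) (mult_op p) (mult_op q)) \<le> ereal s"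
proof (rule op_norm_le[OF _ s])
  fix x assume "x \<in> carrier (hsum (L2 circle_measure) (L2 circle_measure))"
  then obtain f g where f: "square_integrable circle_measure f" and g: "square_integrable circle_measure g"
    and x: "x = (L2_class circle_measure f, L2_class circle_measure g)"
    by (auto simp: hsum_def carrier_L2)
  note sq = square_integrable_poly[OF f] square_integrable_poly[OF g]
  have int: "integrable circle_measure (\<lambda>z. (cmod (poly p z * f z + poly q z * g z))\<^sup>2)"
       "integrable circle_measure (\<lambda>z. (cmod (poly p z * g z))\<^sup>2)"
       "integrable circle_measure (\<lambda>z. (cmod (f z))\<^sup>2)" "integrable circle_measure (\<lambda>z. (cmod (g z))\<^sup>2)"
    using square_integrable_add[OF sq(1)[of p] sq(2)[of q]] sq(2)[of p] f g by (simp_all add: square_integrable_def)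
  have "(\<integral>z. (cmod (poly p z * f z + poly q z * g z))\<^sup>2 + (cmod (poly p z * g z))\<^sup>2 \<partial>circle_measure)
     \<le> (\<integral>z. s\<^sup>2 * ((cmod (f z))\<^sup>2 + (cmod (g z))\<^sup>2) \<partial>circle_measure)"
    using int bd by (intro integral_mono) auto
  also have "\<dots> = s\<^sup>2 * ((\<integral>z. (cmod (f z))\<^sup>2 \<partial>circle_measure) + (\<integral>z. (cmod (g z))\<^sup>2 \<partial>circle_measure))"
    using int by simp
  finally have "sqrt (\<integral>z. (cmod (poly p z * f z + poly q z * g z))\<^sup>2 + (cmod (poly p z * g z))\<^sup>2 \<partial>circle_measure)
     \<le> sqrt (s\<^sup>2 * ((\<integral>z. (cmod (f z))\<^sup>2 \<partial>circle_measure) + (\<integral>z. (cmod (g z))\<^sup>2 \<partial>circle_measure)))"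
    by (rule real_sqrt_le_mono)
  then show "hnorm (hsum (L2 circle_measure) (L2 circle_measure)) (toeplitz (L2 circle_measure) (mult_op p) (mult_op q) x)
      \<le> s * hnorm (hsum (L2 circle_measure) (L2 circle_measure)) x"
    unfolding x hnorm_toeplitz_mult_op[OF f g] hnorm_hsum_L2[OF f g] real_sqrt_mult using s by simp
qed

text \<open>An open set that meets the circle contains an arc.\<close>

lemma circle_open_positive:
  assumes U: "open U" and t: "cmod t = 1" "t \<in> U"
  shows "sphere 0 1 \<inter> U \<in> sets circle_measure" "0 < measure circle_measure (sphere 0 1 \<inter> U)"
proof -
  have "sphere 0 1 \<inter> U \<in> sets (restrict_space borel (sphere 0 1))"
    using U by (auto simp: sets_restrict_space)
  then show E: "sphere 0 1 \<inter> U \<in> sets circle_measure" by (simp add: circle_measure_def)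
  obtain \<theta> where \<theta>: "0 \<le> \<theta>" "\<theta> < 2 * pi" "t = cis \<theta>"
    using t(1) Arg2pi[of t] by (auto simp: cis_conv_exp is_Arg_def)
  have "open (cis -` U)" using U by (intro open_vimage continuous_intros)
  then obtain d where d: "d > 0" "ball \<theta> d \<subseteq> cis -` U"
    using \<theta>(3) t(2) open_contains_ball by (metis vimageI)
  \<comment> \<open>the arc is cut off at \<open>2 * pi\<close>, where the parametrization ends\<close>
  define r where "r = min (\<theta> + d / 2) (2 * pi)"
  have r: "\<theta> < r" "r \<le> 2 * pi" "r < \<theta> + d" using d \<theta> by (auto simp: r_def min_def)
  have sub: "{\<theta>..r} \<subseteq> {0..2 * pi} \<inter> cis -` (sphere 0 1 \<inter> U)"
  proof
    fix x assume "x \<in> {\<theta>..r}"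
    then have "x \<in> ball \<theta> d" "x \<in> {0..2 * pi}" using r \<theta> by (auto simp: dist_norm)
    then show "x \<in> {0..2 * pi} \<inter> cis -` (sphere 0 1 \<inter> U)" using d by auto
  qed
  have "cis -` (sphere 0 1 \<inter> U) = cis -` U" by auto
  then have "cis -` (sphere 0 1 \<inter> U) \<in> sets borel" using \<open>open (cis -` U)\<close> by simp
  then have "emeasure lborel {\<theta>..r} \<le> emeasure lborel ({0..2 * pi} \<inter> cis -` (sphere 0 1 \<inter> U))"
    using sub by (intro emeasure_mono) auto
  moreover have "0 < emeasure lborel {\<theta>..r}" using r by simp
  ultimately have "0 < emeasure lborel ({0..2 * pi} \<inter> cis -` (sphere 0 1 \<inter> U))"
    by (rule less_le_trans[rotated])
  then have "0 < emeasure circle_measure (sphere 0 1 \<inter> U)"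
    by (simp add: emeasure_circle[OF E] ennreal_zero_less_divide)
  then show "0 < measure circle_measure (sphere 0 1 \<inter> U)"
    using finite_measure.emeasure_eq_measure[OF finite_measure_circle] by simp
qed

text \<open>If the bound failed at \<open>t\<close>, it would fail by a margin on a neighbourhood of \<open>t\<close> in the circle.  The
  constant pair \<open>(\<xi>, \<eta>)\<close> times the indicator of that neighbourhood, normalized, then contradicts the
  operator norm.\<close>

lemma op_norm_toeplitz_mult_op_ge:
  assumes r: "0 \<le> r" "op_norm (hsum (L2 circle_measure) (L2 circle_measure)) (toeplitz (L2 circle_measure) (mult_op p) (mult_op q)) \<le> ereal r"
    and t: "cmod t = 1"
  shows "(cmod (poly p t * \<xi> + poly q t * \<eta>))\<^sup>2 + (cmod (poly p t * \<eta>))\<^sup>2 \<le> r\<^sup>2 * ((cmod \<xi>)\<^sup>2 + (cmod \<eta>)\<^sup>2)"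
proof (rule ccontr)
  define \<Phi> where "\<Phi> z = (cmod (poly p z * \<xi> + poly q z * \<eta>))\<^sup>2 + (cmod (poly p z * \<eta>))\<^sup>2" for z
  define n where "n = (cmod \<xi>)\<^sup>2 + (cmod \<eta>)\<^sup>2"
  assume "\<not> ?thesis"
  then obtain m where m: "r\<^sup>2 * n < m" "m < \<Phi> t" unfolding \<Phi>_def n_def by (meson dense not_le)
  have n: "n > 0"
  proof (rule ccontr)
    assume "\<not> n > 0"
    then have "n = 0" by (simp add: n_def add_nonneg_eq_0_iff sum_power2_gt_zero_iff)
    then have "\<xi> = 0" "\<eta> = 0" by (simp_all add: n_def add_nonneg_eq_0_iff)
    then show False using m r by (simp add: \<Phi>_def n_def)
  qed
  define U where "U = {z. m < \<Phi> z}"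
  define E where "E = sphere 0 1 \<inter> U"
  define \<mu> where "\<mu> = measure circle_measure E"
  have "open U" unfolding U_def \<Phi>_def by (intro open_Collect_less continuous_intros)
  then have E: "E \<in> sets circle_measure" and \<mu>: "\<mu> > 0"
    using circle_open_positive[of U t] t m by (auto simp: E_def U_def \<mu>_def)
  have fin: "emeasure circle_measure E < \<infinity>"
    using finite_measure.emeasure_finite[OF finite_measure_circle] by (simp add: top.not_eq_extremum)
  \<comment> \<open>normalizes the test pair\<close>
  define c where "c = 1 / sqrt (n * \<mu>)"
  have c: "c > 0" "c\<^sup>2 * (n * \<mu>) = 1" using n \<mu> by (simp_all add: c_def power_divide)
  have norm_ind: "(cmod (a * of_real (indicator E z)))\<^sup>2 = (cmod a)\<^sup>2 * indicator E z" for a z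
    by (simp add: indicator_def norm_mult)
  have sq: "square_integrable circle_measure (\<lambda>z. a * of_real (indicator E z))" for a
    unfolding square_integrable_def norm_ind using E fin by simp
  let ?f = "\<lambda>z. (of_real c * \<xi>) * complex_of_real (indicator E z)"
  let ?g = "\<lambda>z. (of_real c * \<eta>) * complex_of_real (indicator E z)"
  let ?x = "(L2_class circle_measure ?f, L2_class circle_measure ?g)"
  let ?H = "hsum (L2 circle_measure) (L2 circle_measure)"
  let ?T = "toeplitz (L2 circle_measure) (mult_op p) (mult_op q)"
  have "(\<integral>z. (cmod (?f z))\<^sup>2 \<partial>circle_measure) + (\<integral>z. (cmod (?g z))\<^sup>2 \<partial>circle_measure) = c\<^sup>2 * (n * \<mu>)"
  proof -
    have "E \<inter> sphere 0 1 = E" by (auto simp: E_def)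
    then show ?thesis
      unfolding norm_ind using E by (simp add: norm_mult power_mult_distrib n_def \<mu>_def algebra_simps)
  qed
  then have "hnorm ?H ?x = 1" unfolding hnorm_hsum_L2[OF sq sq] c by simp
  moreover have "?x \<in> carrier ?H" using sq by (auto simp: hsum_def carrier_L2)
  ultimately have "ereal (hnorm ?H (?T ?x)) \<le> op_norm ?H ?T"
    unfolding op_norm_def by (intro SUP_upper) auto
  then have "hnorm ?H (?T ?x) \<le> r" using r(2) order_trans by fastforce
  then have le: "(\<integral>z. (cmod (poly p z * ?f z + poly q z * ?g z))\<^sup>2 + (cmod (poly p z * ?g z))\<^sup>2 \<partial>circle_measure) \<le> r\<^sup>2"
    unfolding hnorm_toeplitz_mult_op[OF sq sq] using r(1) by (simp add: real_sqrt_le_iff' sqrt_le_D)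
  have pt: "(cmod (poly p z * ?f z + poly q z * ?g z))\<^sup>2 + (cmod (poly p z * ?g z))\<^sup>2 = c\<^sup>2 * \<Phi> z * indicator E z" for z
  proof -
    have "poly p z * ?f z + poly q z * ?g z = of_real c * (poly p z * \<xi> + poly q z * \<eta>) * of_real (indicator E z)"
      by (simp add: algebra_simps)
    moreover have "poly p z * ?g z = of_real c * (poly p z * \<eta>) * of_real (indicator E z)"
      by (simp add: algebra_simps)
    moreover have "(cmod (of_real c * w * of_real (indicator E z)))\<^sup>2 = c\<^sup>2 * (cmod w)\<^sup>2 * indicator E z" for w
      unfolding norm_ind by (simp add: norm_mult power_mult_distrib)
    ultimately show ?thesis
      unfolding \<Phi>_def distrib_left[of "c\<^sup>2"] distrib_right[of _ _ "indicat_real E z"] by (simp only:)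
  qed
  note sqp = square_integrable_poly[OF sq]
  have int: "integrable circle_measure (\<lambda>z. (cmod (poly p z * ?f z + poly q z * ?g z))\<^sup>2 + (cmod (poly p z * ?g z))\<^sup>2)"
    using square_integrable_add[OF sqp[of p "of_real c * \<xi>"] sqp[of q "of_real c * \<eta>"]] sqp[of p "of_real c * \<eta>"]
    unfolding square_integrable_def by (intro Bochner_Integration.integrable_add) auto
  have "c\<^sup>2 * m * \<mu> = (\<integral>z. c\<^sup>2 * m * indicator E z \<partial>circle_measure)"
  proof -
    have "E \<inter> sphere 0 1 = E" by (auto simp: E_def)
    then show ?thesis using E by (simp add: \<mu>_def)
  qed
  also have "\<dots> \<le> (\<integral>z. (cmod (poly p z * ?f z + poly q z * ?g z))\<^sup>2 + (cmod (poly p z * ?g z))\<^sup>2 \<partial>circle_measure)"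
  proof (rule integral_mono[OF _ int])
    show "integrable circle_measure (\<lambda>z. c\<^sup>2 * m * indicator E z)" using E fin by simp
    show "c\<^sup>2 * m * indicator E z \<le> (cmod (poly p z * ?f z + poly q z * ?g z))\<^sup>2 + (cmod (poly p z * ?g z))\<^sup>2" for z
      unfolding pt by (auto simp: indicator_def E_def U_def intro!: mult_left_mono)
  qed
  also note le
  also have "r\<^sup>2 = c\<^sup>2 * (r\<^sup>2 * n) * \<mu>" using c by (simp add: algebra_simps)
  also have "\<dots> < c\<^sup>2 * m * \<mu>" using m c \<mu> by (intro mult_strict_right_mono mult_strict_left_mono) auto
  finally show False by simp
qed

section \<open>Scalar pairs on a one-dimensional space\<close>

text \<open>The complex numbers as a Hilbert space whose carrier lies in a given type.\<close>

definition complex_copy :: "(complex \<Rightarrow> 'a) \<Rightarrow> 'a hilb" where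
  "complex_copy e = \<lparr>carrier = range e, mult = undefined, one = undefined, zero = e 0,
     add = (\<lambda>x y. e (the_inv e x + the_inv e y)), smult = (\<lambda>c x. e (c * the_inv e x)),
     ip = (\<lambda>x y. the_inv e x * cnj (the_inv e y))\<rparr>"

context
  fixes e :: "complex \<Rightarrow> 'a"
  assumes inj: "inj e"
begin

lemma complex_copy_simps [simp]:
  "carrier (complex_copy e) = range e" "\<zero>\<^bsub>complex_copy e\<^esub> = e 0"
  "e a \<oplus>\<^bsub>complex_copy e\<^esub> e b = e (a + b)" "c \<odot>\<^bsub>complex_copy e\<^esub> e a = e (c * a)"
  "ip (complex_copy e) (e a) (e b) = a * cnj b"
  using inj by (simp_all add: complex_copy_def the_inv_f_f)

lemma hnorm_complex_copy [simp]: "hnorm (complex_copy e) (e a) = cmod a"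
proof -
  have "Re (a * cnj a) = (cmod a)\<^sup>2" by (simp flip: complex_norm_square)
  then show ?thesis by (simp add: hnorm_def)
qed

lemma module_complex_copy: "Module.module complex_ring (complex_copy e)"
proof (rule module.intro)
  show "cring complex_ring"
  proof (rule cringI)
    show "abelian_group complex_ring"
    proof (rule abelian_groupI)
      show "\<exists>y\<in>carrier complex_ring. y \<oplus>\<^bsub>complex_ring\<^esub> x = \<zero>\<^bsub>complex_ring\<^esub>" for x
        by (rule bexI[of _ "- x"]) simp_all
    qed simp_all
    show "comm_monoid complex_ring"
      by (rule comm_monoidI) (simp_all add: algebra_simps)
  qed (simp_all add: algebra_simps)
  show "abelian_group (complex_copy e)"
  proof (rule abelian_groupI)
    show "\<exists>y\<in>carrier (complex_copy e). y \<oplus>\<^bsub>complex_copy e\<^esub> x = \<zero>\<^bsub>complex_copy e\<^esub>"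
      if "x \<in> carrier (complex_copy e)" for x
    proof -
      from that obtain a where "x = e a" by auto
      then show ?thesis by (intro bexI[of _ "e (- a)"]) simp_all
    qed
  qed (auto simp: algebra_simps)
  show "module_axioms complex_ring (complex_copy e)"
    by unfold_locales (auto simp: algebra_simps)
qed

lemma hdist_complex_copy: "hdist (complex_copy e) (e a) (e b) = dist a b"
proof -
  interpret M: Module.module complex_ring "complex_copy e" by (rule module_complex_copy)
  have "e a \<ominus>\<^bsub>complex_copy e\<^esub> e b = e (a - b)"
  proof -
    have "\<ominus>\<^bsub>complex_copy e\<^esub> e b = e (- b)"
      by (rule M.M.minus_equality) simp_all
    then show ?thesis by (simp add: a_minus_def)
  qed
  then show ?thesis by (simp add: hdist_def dist_norm)
qed

lemma Metric_space_complex_copy: "Metric_space (range e) (hdist (complex_copy e))"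
proof
  fix x y z
  show "0 \<le> hdist (complex_copy e) x y"
    by (cases "x \<in> range e \<and> y \<in> range e") (auto simp: hdist_complex_copy, auto simp: hdist_def)
  show "hdist (complex_copy e) x y = hdist (complex_copy e) y x"
    by (cases "x \<in> range e \<and> y \<in> range e") (auto simp: hdist_complex_copy dist_commute, auto simp: hdist_def)
  show "hdist (complex_copy e) x y = 0 \<longleftrightarrow> x = y" if "x \<in> range e" "y \<in> range e"
    using that inj by (auto simp: hdist_complex_copy dest: injD)
  show "hdist (complex_copy e) x z \<le> hdist (complex_copy e) x y + hdist (complex_copy e) y z"
    if "x \<in> range e" "y \<in> range e" "z \<in> range e"
    using that by (auto simp: hdist_complex_copy dist_triangle)
qed

lemma hilbert_space_complex_copy: "hilbert_space (complex_copy e)"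
proof (rule hilbert_space.intro[OF module_complex_copy], unfold_locales)
  interpret M: Metric_space "range e" "hdist (complex_copy e)" by (rule Metric_space_complex_copy)
  show "Metric_space.mcomplete (carrier (complex_copy e)) (hdist (complex_copy e))"
    unfolding complex_copy_simps M.mcomplete_def
  proof (intro allI impI)
    fix \<sigma> assume \<sigma>: "M.MCauchy \<sigma>"
    then have r: "range \<sigma> \<subseteq> range e" by (simp add: M.MCauchy_def)
    then have "\<forall>n. \<exists>a. \<sigma> n = e a" by blast
    then obtain s where s: "\<And>n. \<sigma> n = e (s n)" by metis
    have "Cauchy s" unfolding Cauchy_def
      using \<sigma> by (simp add: M.MCauchy_def s hdist_complex_copy)
    then obtain l where "s \<longlonglongrightarrow> l" using Cauchy_convergent_iff convergent_def by blast
    then have "limitin M.mtopology \<sigma> (e l) sequentially"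
      unfolding M.limitin_metric by (auto simp: s hdist_complex_copy tendsto_iff)
    then show "\<exists>x. limitin M.mtopology \<sigma> x sequentially" ..
  qed
next
  show "0 < Re (ip (complex_copy e) x x)" if "x \<in> carrier (complex_copy e)" "x \<noteq> \<zero>\<^bsub>complex_copy e\<^esub>" for x
  proof -
    from that obtain a where a: "x = e a" "a \<noteq> 0" by auto
    have "a * cnj a = of_real ((cmod a)\<^sup>2)" by (simp only: complex_norm_square)
    then show ?thesis using a by simp
  qed
qed (auto simp: algebra_simps)

lemma separable_complex_copy: "separable_hilbert_space (complex_copy e)"
  unfolding separable_hilbert_space_def
proof
  show "hilbert_space (complex_copy e)" by (rule hilbert_space_complex_copy)
  interpret M: Metric_space "range e" "hdist (complex_copy e)" by (rule Metric_space_complex_copy)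
  have cont: "continuous_map euclidean M.mtopology e"
    unfolding M.continuous_map_to_metric
  proof (intro ballI allI impI)
    fix a and \<epsilon> :: real assume "\<epsilon> > 0"
    then show "\<exists>U. openin euclidean U \<and> a \<in> U \<and> (\<forall>y\<in>U. e y \<in> M.mball (e a) \<epsilon>)"
      by (intro exI[of _ "ball a \<epsilon>"]) (auto simp: hdist_complex_copy)
  qed
  obtain D :: "complex set" where D: "countable D" "\<And>X. open X \<Longrightarrow> X \<noteq> {} \<Longrightarrow> \<exists>d\<in>D. d \<in> X"
    using countable_dense_setE by blast
  have "closure D = UNIV"
  proof -
    have "x \<in> closure D" for x
      unfolding closure_approachable using D(2)[of "ball x _"] by (force simp: dist_commute)
    then show ?thesis by auto
  qed
  then have "separable_space (euclidean :: complex topology)"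
    unfolding separable_space_def using D(1) by (intro exI[of _ D]) simp
  then show "separable_space (Metric_space.mtopology (carrier (complex_copy e)) (hdist (complex_copy e)))"
    using separable_space_continuous_map_image[OF _ cont] by simp
qed

end

lemma hnorm_hsum_eq:
  "hnorm (hsum H K) (x, y) = sqrt (Re (ip H x x) + Re (ip K y y))"
  by (simp add: hnorm_def hsum_def)

section \<open>The supremum\<close>

lemma op_norm_nonneg: "x \<in> carrier H \<Longrightarrow> hnorm H x \<le> 1 \<Longrightarrow> 0 \<le> hnorm H (A x) \<Longrightarrow> 0 \<le> op_norm H A"
  unfolding op_norm_def by (rule order_trans[of _ "ereal (hnorm H (A x))"]) (auto intro: SUP_upper)

lemma poly_p1: "poly (p1 f) t = partial 1 f 0 + partial 2 f 0 * t"
  by (simp add: p1_def)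

lemma poly_p2: "poly (p2 f) t = 1/2 * partial 1 (partial 1 f) 0 + partial 1 (partial 2 f) 0 * t
    + 1/2 * partial 2 (partial 2 f) 0 * t\<^sup>2"
  by (simp add: p2_def algebra_simps power2_eq_square)

context hilbert_space
begin

lemma finsum_UNIV_2:
  fixes g :: "2 \<Rightarrow> 'a"
  assumes "g 1 \<in> carrier H" "g 2 \<in> carrier H"
  shows "(\<Oplus>i\<in>UNIV. g i) = g 1 \<oplus> g 2"
  unfolding UNIV_2 using assms by (simp add: M.finsum_insert)

lemma D_op_expand:
  assumes "X 1 x \<in> carrier H" "X 2 x \<in> carrier H"
  shows "D_op H f X x = partial 1 f 0 \<odot> X 1 x \<oplus> partial 2 f 0 \<odot> X 2 x"
  unfolding D_op_def using assms by (intro finsum_UNIV_2) auto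

text \<open>Commutativity and the symmetry of the mixed derivatives make the two mixed terms equal, so that half
  of their sum is one of them.\<close>

lemma D2_op_expand:
  assumes X: "bounded_operator H (X 1)" "bounded_operator H (X 2)" and comm: "commuting_ops H (X 1) (X 2)"
    and sym: "partial 1 (partial 2 f) 0 = partial 2 (partial 1 f) 0" and y: "y \<in> carrier H"
  shows "(1/2) \<odot> D2_op H f (A_mat X) y =
     (1/2 * partial 1 (partial 1 f) 0) \<odot> X 1 (X 1 y) \<oplus> partial 1 (partial 2 f) 0 \<odot> X 1 (X 2 y)
       \<oplus> (1/2 * partial 2 (partial 2 f) 0) \<odot> X 2 (X 2 y)"
proof -
  note [simp] = bounded_operatorD(1)[OF X(1)] bounded_operatorD(1)[OF X(2)] y
  let ?c = "partial 1 (partial 2 f) 0" and ?z = "X 1 (X 2 y)"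
  have cm: "X 2 (X 1 y) = ?z" using comm y by (simp add: commuting_ops_def)
  have distr: "c \<odot> (u \<oplus> v) = c \<odot> u \<oplus> c \<odot> v" if "u \<in> carrier H" "v \<in> carrier H" for c u v
    using that smult_r_distr[of c u v] by simp
  have assoc: "(c * d) \<odot> u = c \<odot> (d \<odot> u)" if "u \<in> carrier H" for c d u
    using that smult_assoc1[of c d u] by simp
  have distl: "(c + d) \<odot> u = c \<odot> u \<oplus> d \<odot> u" if "u \<in> carrier H" for c d u
    using that smult_l_distr[of c d u] by simp
  have "?c \<odot> ?z = (1/2 * ?c + 1/2 * ?c) \<odot> ?z" by simp
  also have "\<dots> = (1/2 * ?c) \<odot> ?z \<oplus> (1/2 * ?c) \<odot> ?z" by (rule distl) simp
  finally have half: "?c \<odot> ?z = (1/2) \<odot> (?c \<odot> ?z) \<oplus> (1/2) \<odot> (?c \<odot> ?z)"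
    using assoc[of ?z "1/2" ?c] by simp
  have "D2_op H f (A_mat X) y = (partial 1 (partial 1 f) 0 \<odot> X 1 (X 1 y) \<oplus> ?c \<odot> ?z)
      \<oplus> (?c \<odot> ?z \<oplus> partial 2 (partial 2 f) 0 \<odot> X 2 (X 2 y))"
    unfolding D2_op_def by (subst finsum_UNIV_2; simp add: A_mat_def finsum_UNIV_2 cm sym)
  then have "(1/2) \<odot> D2_op H f (A_mat X) y = ((1/2) \<odot> (partial 1 (partial 1 f) 0 \<odot> X 1 (X 1 y)) \<oplus> (1/2) \<odot> (?c \<odot> ?z))
      \<oplus> ((1/2) \<odot> (?c \<odot> ?z) \<oplus> (1/2) \<odot> (partial 2 (partial 2 f) 0 \<odot> X 2 (X 2 y)))"
    by (simp add: distr)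
  also have "\<dots> = (1/2) \<odot> (partial 1 (partial 1 f) 0 \<odot> X 1 (X 1 y)) \<oplus> ((1/2) \<odot> (?c \<odot> ?z) \<oplus> (1/2) \<odot> (?c \<odot> ?z))
      \<oplus> (1/2) \<odot> (partial 2 (partial 2 f) 0 \<odot> X 2 (X 2 y))"
    by (simp add: M.a_assoc)
  also have "\<dots> = (1/2 * partial 1 (partial 1 f) 0) \<odot> X 1 (X 1 y) \<oplus> ?c \<odot> ?z
      \<oplus> (1/2 * partial 2 (partial 2 f) 0) \<odot> X 2 (X 2 y)"
    unfolding half[symmetric] by (simp only: assoc bounded_operatorD(1)[OF X(1)] bounded_operatorD(1)[OF X(2)] y)
  finally show ?thesis .
qed

lemma hnorm_hsum: "x \<in> carrier H \<Longrightarrow> y \<in> carrier H \<Longrightarrow> hnorm (hsum H H) (x, y) = sqrt ((hnorm H x)\<^sup>2 + (hnorm H y)\<^sup>2)"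
  by (simp add: hnorm_hsum_eq hnorm_sq)

lemma op_norm_contractions_le:
  assumes X: "bounded_operator H (X 1)" "bounded_operator H (X 2)" and comm: "commuting_ops H (X 1) (X 2)"
    and pn: "pair_norm H X \<le> 1"
    and sym: "partial 1 (partial 2 f) 0 = partial 2 (partial 1 f) 0"
    and r: "0 \<le> r"
    and bd: "\<And>t \<xi> \<eta>. cmod t = 1 \<Longrightarrow> (cmod (poly (p1 f) t * \<xi> + poly (p2 f) t * \<eta>))\<^sup>2 + (cmod (poly (p1 f) t * \<eta>))\<^sup>2
        \<le> r\<^sup>2 * ((cmod \<xi>)\<^sup>2 + (cmod \<eta>)\<^sup>2)"
  shows "op_norm (hsum H H) (toeplitz H (D_op H f X) (\<lambda>x. (1/2) \<odot> D2_op H f (A_mat X) x)) \<le> ereal r"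
proof (rule op_norm_le[OF _ r])
  fix z assume "z \<in> carrier (hsum H H)"
  then obtain x y where z: "z = (x, y)" and xy: "x \<in> carrier H" "y \<in> carrier H" by (auto simp: hsum_def)
  note [simp] = bounded_operatorD(1)[OF X(1)] bounded_operatorD(1)[OF X(2)] xy
  have contr: "op_norm H (X 1) \<le> 1" "op_norm H (X 2) \<le> 1" using pn by (auto simp: pair_norm_def)
  define u where "u = (partial 1 f 0 \<odot> X 1 x \<oplus> partial 2 f 0 \<odot> X 2 x) \<oplus>
     ((1/2 * partial 1 (partial 1 f) 0) \<odot> X 1 (X 1 y) \<oplus> partial 1 (partial 2 f) 0 \<odot> X 1 (X 2 y)
       \<oplus> (1/2 * partial 2 (partial 2 f) 0) \<odot> X 2 (X 2 y))"
  define v where "v = partial 1 f 0 \<odot> X 1 y \<oplus> partial 2 f 0 \<odot> X 2 y"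
  have uv: "u \<in> carrier H" "v \<in> carrier H" by (simp_all add: u_def v_def)
  have T: "toeplitz H (D_op H f X) (\<lambda>x. (1/2) \<odot> D2_op H f (A_mat X) x) z = (u, v)"
    unfolding z toeplitz_def u_def v_def by (simp add: D_op_expand D2_op_expand[OF X comm sym])
  have "(hnorm H u)\<^sup>2 + (hnorm H v)\<^sup>2 \<le> r\<^sup>2 * ((hnorm H x)\<^sup>2 + (hnorm H y)\<^sup>2)"
    unfolding u_def v_def
    by (rule toeplitz_commuting_contractions[OF X(1) contr(1) X(2) contr(2) comm xy])
       (rule bd[unfolded poly_p1 poly_p2])
  then have "sqrt ((hnorm H u)\<^sup>2 + (hnorm H v)\<^sup>2) \<le> sqrt (r\<^sup>2 * ((hnorm H x)\<^sup>2 + (hnorm H y)\<^sup>2))"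
    by (rule real_sqrt_le_mono)
  then show "hnorm (hsum H H) (toeplitz H (D_op H f X) (\<lambda>x. (1/2) \<odot> D2_op H f (A_mat X) x) z) \<le> r * hnorm (hsum H H) z"
    unfolding T unfolding z hnorm_hsum[OF uv] hnorm_hsum[OF xy] real_sqrt_mult using r by simp
qed

end

text \<open>For \<open>cmod t = 1\<close>, the commuting pair of unitary operators \<open>(1, t)\<close>.\<close>

definition scalar_pair :: "(complex \<Rightarrow> 'a) \<Rightarrow> complex \<Rightarrow> 2 \<Rightarrow> 'a \<Rightarrow> 'a" where
  "scalar_pair e t i x = e ((if i = 1 then 1 else t) * the_inv e x)"

lemma scalar_pair_admissible:
  assumes inj: "inj e" and t: "cmod t = 1"
  shows "bounded_operator (complex_copy e) (scalar_pair e t i)"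
    "commuting_ops (complex_copy e) (scalar_pair e t 1) (scalar_pair e t 2)"
    "pair_norm (complex_copy e) (scalar_pair e t) \<le> 1"
proof -
  note [simp] = complex_copy_simps[OF inj] hnorm_complex_copy[OF inj] the_inv_f_f[OF inj]
  have n: "cmod (if i = 1 then 1 else t) = 1" for i :: 2 using t by simp
  show "bounded_operator (complex_copy e) (scalar_pair e t i)"
    unfolding bounded_operator_def
    by (auto simp: scalar_pair_def norm_mult t algebra_simps intro!: exI[of _ 1])
  show "commuting_ops (complex_copy e) (scalar_pair e t 1) (scalar_pair e t 2)"
    by (auto simp: commuting_ops_def scalar_pair_def algebra_simps)
  have "op_norm (complex_copy e) (scalar_pair e t i) \<le> ereal 1" for i
    by (rule op_norm_le) (auto simp: scalar_pair_def norm_mult t)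
  then show "pair_norm (complex_copy e) (scalar_pair e t) \<le> 1"
    unfolding pair_norm_def by (simp flip: one_ereal_def)
qed

lemma toeplitz_scalar_pair:
  assumes inj: "inj e" and t: "cmod t = 1" and sym: "partial 1 (partial 2 f) 0 = partial 2 (partial 1 f) 0"
  shows "toeplitz (complex_copy e) (D_op (complex_copy e) f (scalar_pair e t))
      (\<lambda>x. (1/2) \<odot>\<^bsub>complex_copy e\<^esub> D2_op (complex_copy e) f (A_mat (scalar_pair e t)) x) (e \<xi>, e \<eta>)
     = (e (poly (p1 f) t * \<xi> + poly (p2 f) t * \<eta>), e (poly (p1 f) t * \<eta>))"
proof -
  note [simp] = complex_copy_simps[OF inj] the_inv_f_f[OF inj]
  interpret hilbert_space "complex_copy e" by (rule hilbert_space_complex_copy[OF inj])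
  have X: "scalar_pair e t 1 (e a) = e a" "scalar_pair e t 2 (e a) = e (t * a)" for a
    by (simp_all add: scalar_pair_def)
  show ?thesis
    unfolding toeplitz_def
    by (simp add: D_op_expand D2_op_expand[OF scalar_pair_admissible(1,1,2)[OF inj t] sym] X poly_p1 poly_p2
        algebra_simps power2_eq_square)
qed

lemma op_norm_scalar_pair_nonneg:
  assumes inj: "inj e" and t: "cmod t = 1" and sym: "partial 1 (partial 2 f) 0 = partial 2 (partial 1 f) 0"
  shows "0 \<le> op_norm (hsum (complex_copy e) (complex_copy e)) (toeplitz (complex_copy e) (D_op (complex_copy e) f (scalar_pair e t))
      (\<lambda>x. (1/2) \<odot>\<^bsub>complex_copy e\<^esub> D2_op (complex_copy e) f (A_mat (scalar_pair e t)) x))"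
  by (rule op_norm_nonneg[of "(e 0, e 0)"])
     (simp_all only: toeplitz_scalar_pair[OF inj t sym] hnorm_hsum_eq complex_copy_simps[OF inj], simp_all add: hsum_def complex_copy_simps[OF inj])

lemma op_norm_scalar_pair_ge:
  assumes inj: "inj e" and t: "cmod t = 1" and sym: "partial 1 (partial 2 f) 0 = partial 2 (partial 1 f) 0"
    and s: "op_norm (hsum (complex_copy e) (complex_copy e)) (toeplitz (complex_copy e) (D_op (complex_copy e) f (scalar_pair e t))
      (\<lambda>x. (1/2) \<odot>\<^bsub>complex_copy e\<^esub> D2_op (complex_copy e) f (A_mat (scalar_pair e t)) x)) \<le> ereal s"
  shows "(cmod (poly (p1 f) t * \<xi> + poly (p2 f) t * \<eta>))\<^sup>2 + (cmod (poly (p1 f) t * \<eta>))\<^sup>2 \<le> s\<^sup>2 * ((cmod \<xi>)\<^sup>2 + (cmod \<eta>)\<^sup>2)"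
proof (cases "\<xi> = 0 \<and> \<eta> = 0")
  case False
  note [simp] = complex_copy_simps[OF inj]
  interpret hilbert_space "complex_copy e" by (rule hilbert_space_complex_copy[OF inj])
  let ?H = "hsum (complex_copy e) (complex_copy e)"
  let ?T = "toeplitz (complex_copy e) (D_op (complex_copy e) f (scalar_pair e t))
      (\<lambda>x. (1/2) \<odot>\<^bsub>complex_copy e\<^esub> D2_op (complex_copy e) f (A_mat (scalar_pair e t)) x)"
  have n: "hnorm ?H (e a, e b) = sqrt ((cmod a)\<^sup>2 + (cmod b)\<^sup>2)" for a b
    using hnorm_hsum[of "e a" "e b"] by (simp add: hnorm_complex_copy[OF inj])
  have car: "z \<in> carrier ?H \<longleftrightarrow> (\<exists>a b. z = (e a, e b))" for z
    by (auto simp: hsum_def)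
  have sm: "c \<odot>\<^bsub>?H\<^esub> (e a, e b) = (e (c * a), e (c * b))" for c a b by (simp add: hsum_def)
  note T = toeplitz_scalar_pair[OF inj t sym]
  have "hnorm ?H (?T (e \<xi>, e \<eta>)) \<le> s * hnorm ?H (e \<xi>, e \<eta>)"
  proof (rule op_norm_bound[OF _ _ _ _ s])
    show "c \<odot>\<^bsub>?H\<^esub> z \<in> carrier ?H" if "z \<in> carrier ?H" for c z
      using that unfolding car by (auto simp: sm)
    show "hnorm ?H (c \<odot>\<^bsub>?H\<^esub> z) = cmod c * hnorm ?H z" if "z \<in> carrier ?H" for c z
      using that unfolding car
      by (auto simp: sm n norm_mult power_mult_distrib real_sqrt_mult simp flip: distrib_left)
    show "?T (c \<odot>\<^bsub>?H\<^esub> z) = c \<odot>\<^bsub>?H\<^esub> ?T z" if "z \<in> carrier ?H" for c z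
    proof -
      obtain a b where z: "z = (e a, e b)" using \<open>z \<in> carrier ?H\<close> car by blast
      show ?thesis unfolding z sm T by (simp add: algebra_simps)
    qed
    show "?T z \<in> carrier ?H" if "z \<in> carrier ?H" for z
    proof -
      obtain a b where z: "z = (e a, e b)" using \<open>z \<in> carrier ?H\<close> car by blast
      show ?thesis unfolding z T car by blast
    qed
    show "(e \<xi>, e \<eta>) \<in> carrier ?H" unfolding car by blast
    show "0 < hnorm ?H (e \<xi>, e \<eta>)" unfolding n using False by (simp add: sum_power2_gt_zero_iff)
  qed
  then have "(sqrt ((cmod (poly (p1 f) t * \<xi> + poly (p2 f) t * \<eta>))\<^sup>2 + (cmod (poly (p1 f) t * \<eta>))\<^sup>2))\<^sup>2
      \<le> (s * sqrt ((cmod \<xi>)\<^sup>2 + (cmod \<eta>)\<^sup>2))\<^sup>2"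
    unfolding T n by (rule power_mono) simp
  then show ?thesis by (simp add: power_mult_distrib)
qed simp

theorem theorem1p15:
  fixes f :: "complex ^ 2 \<Rightarrow> complex"
  assumes "holomorphic2_on f bidisc"
    and "f 0 = 0"
    and "\<forall>z\<in>bidisc. norm (f z) \<le> 1"
    and "\<exists>e :: complex \<Rightarrow> 'a. inj e"
  shows "(SUP (H, X) \<in> {(H :: 'a hilb, X :: 2 \<Rightarrow> 'a \<Rightarrow> 'a).
             separable_hilbert_space H \<and> carrier H \<noteq> {\<zero>\<^bsub>H\<^esub>} \<and>
             (\<forall>i. bounded_operator H (X i)) \<and> commuting_ops H (X 1) (X 2) \<and>
             pair_norm H X \<le> 1}.
           op_norm (hsum H H)
             (toeplitz H (D_op H f X) (\<lambda>x. (1/2) \<odot>\<^bsub>H\<^esub> D2_op H f (A_mat X) x)))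
         = op_norm (hsum (L2 circle_measure) (L2 circle_measure))
             (toeplitz (L2 circle_measure) (mult_op (p1 f)) (mult_op (p2 f)))"
    (is "?L = ?R")
proof (rule antisym)
  have sym: "partial 1 (partial 2 f) 0 = partial 2 (partial 1 f) 0"
    using assms(1,3) by (rule partial_symmetric)
  have R0: "0 \<le> ?R"
  proof (rule op_norm_nonneg)
    have sq: "square_integrable circle_measure (\<lambda>z. 0)" by (simp add: square_integrable_def)
    let ?z = "(L2_class circle_measure (\<lambda>z. 0), L2_class circle_measure (\<lambda>z. 0))"
    show "?z \<in> carrier (hsum (L2 circle_measure) (L2 circle_measure))"
      using sq by (auto simp: hsum_def carrier_L2)
    show "hnorm (hsum (L2 circle_measure) (L2 circle_measure)) ?z \<le> 1"
      by (simp add: hnorm_hsum_L2[OF sq sq])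
    show "0 \<le> hnorm (hsum (L2 circle_measure) (L2 circle_measure))
        (toeplitz (L2 circle_measure) (mult_op (p1 f)) (mult_op (p2 f)) ?z)"
      by (simp add: hnorm_toeplitz_mult_op[OF sq sq])
  qed
  show "?L \<le> ?R"
  proof (cases ?R)
    case (real r)
    then have r: "0 \<le> r" using R0 by simp
    show ?thesis unfolding real
    proof (rule SUP_least, clarify)
      fix H :: "'a hilb" and X :: "2 \<Rightarrow> 'a \<Rightarrow> 'a"
      assume H: "separable_hilbert_space H" and X: "\<forall>i. bounded_operator H (X i)"
        and comm: "commuting_ops H (X 1) (X 2)" and pn: "pair_norm H X \<le> 1"
      interpret hilbert_space H using H by (simp add: separable_hilbert_space_def)
      show "op_norm (hsum H H) (toeplitz H (D_op H f X) (\<lambda>x. (1/2) \<odot>\<^bsub>H\<^esub> D2_op H f (A_mat X) x)) \<le> ereal r"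
        using X real
        by (intro op_norm_contractions_le comm pn sym r op_norm_toeplitz_mult_op_ge[OF r]) auto
    qed
  next
    case PInf
    then show ?thesis by simp
  next
    case MInf
    with R0 show ?thesis by simp
  qed
  obtain e :: "complex \<Rightarrow> 'a" where inj: "inj e" using assms(4) by blast
  have upper: "op_norm (hsum (complex_copy e) (complex_copy e)) (toeplitz (complex_copy e) (D_op (complex_copy e) f (scalar_pair e t))
      (\<lambda>x. (1/2) \<odot>\<^bsub>complex_copy e\<^esub> D2_op (complex_copy e) f (A_mat (scalar_pair e t)) x)) \<le> ?L"
    if "cmod t = 1" for t
  proof -
    have "e 1 \<noteq> e 0" using inj by (metis injD zero_neq_one)
    then have ne: "carrier (complex_copy e) \<noteq> {\<zero>\<^bsub>complex_copy e\<^esub>}"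
      using complex_copy_simps[OF inj] by auto
    show ?thesis
      by (rule SUP_upper2[of "(complex_copy e, scalar_pair e t)"])
         (use ne scalar_pair_admissible[OF inj that] separable_complex_copy[OF inj] in auto)
  qed
  have L0: "0 \<le> ?L"
    using op_norm_scalar_pair_nonneg[OF inj _ sym, of 1] upper[of 1] order_trans by fastforce
  show "?R \<le> ?L"
  proof (cases ?L)
    case (real s)
    have bd: "(cmod (poly (p1 f) t * \<xi> + poly (p2 f) t * \<eta>))\<^sup>2 + (cmod (poly (p1 f) t * \<eta>))\<^sup>2
        \<le> s\<^sup>2 * ((cmod \<xi>)\<^sup>2 + (cmod \<eta>)\<^sup>2)" if "cmod t = 1" for t \<xi> \<eta>
      using upper[OF that] unfolding real by (rule op_norm_scalar_pair_ge[OF inj that sym])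
    have "?R \<le> ereal \<bar>s\<bar>"
      by (rule op_norm_toeplitz_mult_op_le) (use bd in simp_all)
    moreover have "0 \<le> s" using L0 real by simp
    ultimately show ?thesis using real by simp
  next
    case PInf
    then show ?thesis by simp
  next
    case MInf
    with L0 show ?thesis by simp
  qed
qed

end
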